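(* For every integer $n\ge 1$ and every integer $m\ge 0$, $$\frac{1}{n!}\,\mathrm{CT}_x\, \frac{\prod_{1\le i\ne j \le n}\left(1-\frac{x_i}{x_j}\right)\prod_{i=1}^n(1+x_i^{-1})^m}{\prod_{i=1}^n(1-x_i) \prod_{1\le i<j\le n} (1-x_ix_j) } =\prod_{j=0}^{n-1}\prod_{i=1}^m \frac{2i+j}{i+j}.$$
   Context: The rational function is viewed in the ring $\mathbb{Q}((x_1,\dots,x_n))$ of formal Laurent series; that is, $\frac{1}{1-x_i}$ and $\frac{1}{1-x_ix_j}$ are expanded as power series in the $x$'s. $\mathrm{CT}_x$ denotes the constant term in all variables $x_1,\dots,x_n$. The product over $1\le i\ne j\le n$ runs over all ordered pairs $(i,j)$ with $i\neq j$. *)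

theory Defs
  imports Complex_Main "HOL-Library.Poly_Mapping"
begin

text \<open>
  Formal Laurent series in the variables \<open>x\<^sub>0, x\<^sub>1, \<dots>\<close>.  A monomial is given by its exponent
  vector, of type \<^typ>\<open>nat \<Rightarrow>\<^sub>0 int\<close>.  A series may involve only finitely many variables, and its
  exponents are bounded below; the type is thus the union over \<open>n\<close> of the rings
  \<open>R((x\<^sub>1, \<dots>, x\<^sub>n)) = R[[x\<^sub>1, \<dots>, x\<^sub>n]][x\<^sub>1\<^sup>-\<^sup>1, \<dots>, x\<^sub>n\<^sup>-\<^sup>1]\<close>.  This keeps \<open>n\<close> an ordinary
  natural number instead of a type.
\<close>

definition expvec_bounded :: "nat \<Rightarrow> (nat \<Rightarrow>\<^sub>0 int) \<Rightarrow> bool" where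
  "expvec_bounded N e \<longleftrightarrow> Poly_Mapping.keys e \<subseteq> {..<N} \<and> (\<forall>i. - int N \<le> Poly_Mapping.lookup e i)"

typedef (overloaded) ('a::zero) mlaurent =
  "{f :: (nat \<Rightarrow>\<^sub>0 int) \<Rightarrow> 'a. \<exists>N. \<forall>e. f e \<noteq> 0 \<longrightarrow> expvec_bounded N e}"
  morphisms mcoeff Abs_mlaurent
  by (rule exI[of _ "\<lambda>_. 0"]) simp

setup_lifting type_definition_mlaurent

lemma mlaurent_eqI: "(\<And>e. mcoeff f e = mcoeff g e) \<Longrightarrow> f = g"
  by (simp add: mcoeff_inject[symmetric] ext)

lemma mcoeff_bounded: "\<exists>N. \<forall>e. mcoeff f e \<noteq> 0 \<longrightarrow> expvec_bounded N e"
  using mcoeff[of f] by simp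

lemma expvec_bounded_mono: "expvec_bounded M e \<Longrightarrow> M \<le> N \<Longrightarrow> expvec_bounded N e"
  unfolding expvec_bounded_def by (auto intro: order_trans[of "- int N" "- int M"])

lemma expvec_bounded_add:
  assumes "expvec_bounded M a" "expvec_bounded N b"
  shows "expvec_bounded (M + N) (a + b)"
proof -
  have "Poly_Mapping.keys (a + b) \<subseteq> {..<M + N}"
    using assms Poly_Mapping.keys_add[of a b] unfolding expvec_bounded_def by fastforce
  moreover have "- int (M + N) \<le> Poly_Mapping.lookup (a + b) i" for i
  proof -
    have "- int M \<le> Poly_Mapping.lookup a i" "- int N \<le> Poly_Mapping.lookup b i"
      using assms unfolding expvec_bounded_def by auto
    then show ?thesis by (simp add: lookup_add)
  qed
  ultimately show ?thesis unfolding expvec_bounded_def by blast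
qed

lemma finite_expvec_splits:
  "finite {a. expvec_bounded M a \<and> expvec_bounded N (e - a)}"
proof -
  let ?B = "\<Union>i<M. {- int M .. Poly_Mapping.lookup e i + int N}"
  let ?F = "{f. \<forall>i. (i \<in> {..<M} \<longrightarrow> f i \<in> ?B) \<and> (i \<notin> {..<M} \<longrightarrow> f i = (0::int))}"
  have "finite ?F" by (rule finite_set_of_finite_funs) auto
  moreover have "Poly_Mapping.lookup ` {a. expvec_bounded M a \<and> expvec_bounded N (e - a)} \<subseteq> ?F"
  proof (safe, goal_cases)
    case (1 _ a i)
    have "- int M \<le> Poly_Mapping.lookup a i" "- int N \<le> Poly_Mapping.lookup (e - a) i"
      using 1 unfolding expvec_bounded_def by auto
    then show ?case using 1 by (auto simp: lookup_minus intro!: bexI[of _ i])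
  next
    case (2 _ a i)
    then show ?case unfolding expvec_bounded_def by (auto simp: in_keys_iff)
  qed
  ultimately have "finite (Poly_Mapping.lookup ` {a. expvec_bounded M a \<and> expvec_bounded N (e - a)})"
    by (rule rev_finite_subset)
  then show ?thesis
    by (rule finite_imageD) (auto intro!: inj_onI poly_mapping_eqI)
qed

lemma finite_mcoeff_splits: "finite {a. mcoeff f a \<noteq> 0 \<and> mcoeff g (e - a) \<noteq> 0}"
proof -
  obtain M N where "\<forall>a. mcoeff f a \<noteq> 0 \<longrightarrow> expvec_bounded M a"
    "\<forall>a. mcoeff g a \<noteq> 0 \<longrightarrow> expvec_bounded N a"
    using mcoeff_bounded[of f] mcoeff_bounded[of g] by blast
  then show ?thesis by (intro finite_subset[OF _ finite_expvec_splits[of M N e]]) auto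
qed

instantiation mlaurent :: (comm_ring_1) comm_ring_1
begin

lift_definition zero_mlaurent :: "'a mlaurent" is "\<lambda>_. 0" by simp

lift_definition one_mlaurent :: "'a mlaurent" is "\<lambda>e. if e = 0 then 1 else 0"
  by (rule exI[of _ 0]) (auto simp: expvec_bounded_def)

lift_definition plus_mlaurent :: "'a mlaurent \<Rightarrow> 'a mlaurent \<Rightarrow> 'a mlaurent"
  is "\<lambda>f g e. f e + g e"
proof (elim exE)
  fix f g :: "(nat \<Rightarrow>\<^sub>0 int) \<Rightarrow> 'a" and M N
  assume *: "\<forall>e. f e \<noteq> 0 \<longrightarrow> expvec_bounded M e" "\<forall>e. g e \<noteq> 0 \<longrightarrow> expvec_bounded N e"
  have "\<forall>e. f e + g e \<noteq> 0 \<longrightarrow> expvec_bounded (M + N) e"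
    using * by (metis add.right_neutral expvec_bounded_mono le_add1 le_add2)
  then show "\<exists>N. \<forall>e. f e + g e \<noteq> 0 \<longrightarrow> expvec_bounded N e" by blast
qed

lift_definition uminus_mlaurent :: "'a mlaurent \<Rightarrow> 'a mlaurent" is "\<lambda>f e. - f e" by simp

definition minus_mlaurent :: "'a mlaurent \<Rightarrow> 'a mlaurent \<Rightarrow> 'a mlaurent" where
  "minus_mlaurent f g = f + - g"

definition times_mlaurent :: "'a mlaurent \<Rightarrow> 'a mlaurent \<Rightarrow> 'a mlaurent" where
  "times_mlaurent f g = Abs_mlaurent
     (\<lambda>e. \<Sum>a | mcoeff f a \<noteq> 0 \<and> mcoeff g (e - a) \<noteq> 0. mcoeff f a * mcoeff g (e - a))"

lemma mcoeff_times:
  fixes f g :: "'a mlaurent"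
  shows "mcoeff (f * g) e =
    (\<Sum>a | mcoeff f a \<noteq> 0 \<and> mcoeff g (e - a) \<noteq> 0. mcoeff f a * mcoeff g (e - a))"
proof -
  let ?h = "\<lambda>e. \<Sum>a | mcoeff f a \<noteq> 0 \<and> mcoeff g (e - a) \<noteq> 0. mcoeff f a * mcoeff g (e - a)"
  obtain M N where *: "\<forall>a. mcoeff f a \<noteq> 0 \<longrightarrow> expvec_bounded M a"
    "\<forall>a. mcoeff g a \<noteq> 0 \<longrightarrow> expvec_bounded N a"
    using mcoeff_bounded[of f] mcoeff_bounded[of g] by blast
  have "expvec_bounded (M + N) e" if "?h e \<noteq> 0" for e
  proof -
    from that obtain a where "mcoeff f a \<noteq> 0" "mcoeff g (e - a) \<noteq> 0"
      by (auto elim: sum.not_neutral_contains_not_neutral)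
    then show ?thesis using * expvec_bounded_add[of M a N "e - a"] by simp
  qed
  then have "?h \<in> {f. \<exists>N. \<forall>e. f e \<noteq> 0 \<longrightarrow> expvec_bounded N e}" by blast
  then show ?thesis unfolding times_mlaurent_def by (simp add: Abs_mlaurent_inverse)
qed

lemma mcoeff_times_superset:
  fixes f g :: "'a mlaurent"
  assumes "finite S" "{a. mcoeff f a \<noteq> 0 \<and> mcoeff g (e - a) \<noteq> 0} \<subseteq> S"
  shows "mcoeff (f * g) e = (\<Sum>a\<in>S. mcoeff f a * mcoeff g (e - a))"
  unfolding mcoeff_times by (rule sum.mono_neutral_left) (use assms in auto)

lemma mlaurent_mult_commute:
  fixes f g :: "'a mlaurent"
  shows "f * g = g * f"
proof (rule mlaurent_eqI)
  fix e
  show "mcoeff (f * g) e = mcoeff (g * f) e"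
    unfolding mcoeff_times
    by (rule sum.reindex_bij_witness[of _ "\<lambda>a. e - a" "\<lambda>a. e - a"]) (auto simp: mult.commute)
qed

lemma mlaurent_mult_assoc:
  fixes f g h :: "'a mlaurent"
  shows "(f * g) * h = f * (g * h)"
proof (rule mlaurent_eqI)
  fix e
  let ?S = "{a. mcoeff f a \<noteq> 0 \<and> (\<exists>c. mcoeff h c \<noteq> 0 \<and> mcoeff g (e - c - a) \<noteq> 0)}"
  let ?T = "{c. mcoeff h c \<noteq> 0 \<and> (\<exists>a. mcoeff f a \<noteq> 0 \<and> mcoeff g (e - c - a) \<noteq> 0)}"
  obtain L M N where *: "\<And>a. mcoeff f a \<noteq> 0 \<Longrightarrow> expvec_bounded L a"
    "\<And>a. mcoeff g a \<noteq> 0 \<Longrightarrow> expvec_bounded M a" "\<And>a. mcoeff h a \<noteq> 0 \<Longrightarrow> expvec_bounded N a"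
    using mcoeff_bounded[of f] mcoeff_bounded[of g] mcoeff_bounded[of h] by blast
  have S: "finite ?S"
  proof (rule finite_subset[OF _ finite_expvec_splits[of L "M + N" e]], safe)
    fix a c assume "mcoeff h c \<noteq> 0" "mcoeff g (e - c - a) \<noteq> 0"
    then show "expvec_bounded (M + N) (e - a)"
      using expvec_bounded_add[of M "e - c - a" N c] * by (simp add: algebra_simps)
  qed (use * in auto)
  have T: "finite ?T"
  proof (rule finite_subset[OF _ finite_expvec_splits[of N "M + L" e]], safe)
    fix a c assume "mcoeff f a \<noteq> 0" "mcoeff g (e - c - a) \<noteq> 0"
    then show "expvec_bounded (M + L) (e - c)"
      using expvec_bounded_add[of M "e - c - a" L a] * by (simp add: algebra_simps)
  qed (use * in auto)
  have nz: "\<exists>a. mcoeff u a \<noteq> 0 \<and> mcoeff v (d - a) \<noteq> 0" if "mcoeff (u * v) d \<noteq> 0"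
    for u v :: "'a mlaurent" and d
    using that unfolding mcoeff_times by (auto elim: sum.not_neutral_contains_not_neutral)
  have "mcoeff ((f * g) * h) e = mcoeff (h * (f * g)) e"
    by (subst mlaurent_mult_commute) (rule refl)
  also have "\<dots> = (\<Sum>c\<in>?T. mcoeff h c * mcoeff (f * g) (e - c))"
    by (rule mcoeff_times_superset[OF T]) (auto dest: nz)
  also have "\<dots> = (\<Sum>c\<in>?T. \<Sum>a\<in>?S. mcoeff h c * (mcoeff f a * mcoeff g (e - c - a)))"
    by (rule sum.cong[OF refl], subst mcoeff_times_superset[OF S]) (auto simp: sum_distrib_left)
  also have "\<dots> = (\<Sum>a\<in>?S. \<Sum>c\<in>?T. mcoeff f a * (mcoeff h c * mcoeff g (e - a - c)))"
    by (subst sum.swap) (auto intro!: sum.cong simp: algebra_simps)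
  also have "\<dots> = (\<Sum>a\<in>?S. mcoeff f a * mcoeff (h * g) (e - a))"
  proof (rule sum.cong[OF refl])
    fix a assume a: "a \<in> ?S"
    have "mcoeff (h * g) (e - a) = (\<Sum>c\<in>?T. mcoeff h c * mcoeff g (e - a - c))"
    proof (rule mcoeff_times_superset[OF T], safe)
      fix c assume "mcoeff g (e - a - c) \<noteq> 0"
      then have "mcoeff g (e - c - a) \<noteq> 0" by (subst diff_right_commute)
      then show "\<exists>a. mcoeff f a \<noteq> 0 \<and> mcoeff g (e - c - a) \<noteq> 0" using a by blast
    qed
    then show "(\<Sum>c\<in>?T. mcoeff f a * (mcoeff h c * mcoeff g (e - a - c)))
        = mcoeff f a * mcoeff (h * g) (e - a)"
      by (simp only: sum_distrib_left)
  qed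
  also have "\<dots> = mcoeff (f * (h * g)) e"
  proof (rule mcoeff_times_superset[OF S, symmetric], safe)
    fix a assume "mcoeff (h * g) (e - a) \<noteq> 0"
    then obtain c where "mcoeff h c \<noteq> 0" "mcoeff g (e - a - c) \<noteq> 0" using nz by blast
    moreover from this(2) have "mcoeff g (e - c - a) \<noteq> 0" by (subst diff_right_commute)
    ultimately show "\<exists>c. mcoeff h c \<noteq> 0 \<and> mcoeff g (e - c - a) \<noteq> 0" by auto
  qed
  finally show "mcoeff ((f * g) * h) e = mcoeff (f * (g * h)) e"
    by (simp only: mlaurent_mult_commute[of h g])
qed

instance
proof
  fix f g h :: "'a mlaurent"
  show "f * g * h = f * (g * h)" by (rule mlaurent_mult_assoc)
  show "f * g = g * f" by (rule mlaurent_mult_commute)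
  show "1 * f = f"
  proof (rule mlaurent_eqI)
    fix e
    have "mcoeff (1 * f) e = (\<Sum>a\<in>{0}. mcoeff 1 a * mcoeff f (e - a))"
      by (rule mcoeff_times_superset) (auto simp: one_mlaurent.rep_eq split: if_splits)
    then show "mcoeff (1 * f) e = mcoeff f e" by (simp add: one_mlaurent.rep_eq)
  qed
  show "f + g + h = f + (g + h)" "f + g = g + f" "0 + f = f" "- f + f = 0" "f - g = f + - g"
    unfolding minus_mlaurent_def by (transfer; simp add: algebra_simps fun_eq_iff)+
  show "(0::'a mlaurent) \<noteq> 1" by transfer (auto simp: fun_eq_iff)
  show "(f + g) * h = f * h + g * h"
  proof (rule mlaurent_eqI)
    fix e
    let ?S = "{a. mcoeff f a \<noteq> 0 \<and> mcoeff h (e - a) \<noteq> 0} \<union> {a. mcoeff g a \<noteq> 0 \<and> mcoeff h (e - a) \<noteq> 0}"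
    have S: "finite ?S" by (simp add: finite_mcoeff_splits)
    have "mcoeff (u * h) e = (\<Sum>a\<in>?S. mcoeff u a * mcoeff h (e - a))" if "u \<in> {f, g, f + g}" for u
      by (rule mcoeff_times_superset[OF S]) (use that in \<open>auto simp: plus_mlaurent.rep_eq\<close>)
    then show "mcoeff ((f + g) * h) e = mcoeff (f * h + g * h) e"
      by (simp add: plus_mlaurent.rep_eq algebra_simps sum.distrib)
  qed
qed

end

text \<open>
  The ring is not a field: \<^term>\<open>inverse f\<close> is the multiplicative inverse, which is unique if it
  exists, and \<open>0\<close> if \<open>f\<close> is not a unit.  As the ring contains the power series,
  \<open>1 / (1 - x\<^sub>i)\<close> and \<open>1 / (1 - x\<^sub>i x\<^sub>j)\<close> are the geometric series in \<open>x\<^sub>i\<close> and \<open>x\<^sub>i x\<^sub>j\<close>.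
\<close>

instantiation mlaurent :: (comm_ring_1) inverse
begin

definition inverse_mlaurent :: "'a mlaurent \<Rightarrow> 'a mlaurent" where
  "inverse_mlaurent f = (if \<exists>g. f * g = 1 then THE g. f * g = 1 else 0)"

definition divide_mlaurent :: "'a mlaurent \<Rightarrow> 'a mlaurent \<Rightarrow> 'a mlaurent" where
  "divide_mlaurent f g = f * inverse g"

instance ..

end

lemma mlaurent_inverse_unique:
  fixes f g :: "'a::comm_ring_1 mlaurent"
  assumes "f * g = 1"
  shows "inverse f = g"
proof -
  have "g' = g" if "f * g' = 1" for g'
    using assms that by (metis mult.assoc mult.commute mult_1)
  then have "(THE g. f * g = 1) = g" using assms by (intro the_equality)
  then show ?thesis unfolding inverse_mlaurent_def using assms by auto
qed

definition mmonom :: "(nat \<Rightarrow>\<^sub>0 int) \<Rightarrow> 'a::comm_ring_1 mlaurent" where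
  "mmonom d = Abs_mlaurent (\<lambda>e. if e = d then 1 else 0)"

lemma mcoeff_mmonom: "mcoeff (mmonom d) = (\<lambda>e. if e = d then 1 else 0)"
proof -
  obtain K where K: "Poly_Mapping.keys d \<subseteq> {..<K}"
    using finite_nat_set_iff_bounded[of "Poly_Mapping.keys d"] by auto
  let ?N = "K + (\<Sum>i\<in>Poly_Mapping.keys d. nat \<bar>Poly_Mapping.lookup d i\<bar>)"
  have "- int ?N \<le> Poly_Mapping.lookup d i" for i
  proof (cases "i \<in> Poly_Mapping.keys d")
    case True
    have "nat \<bar>Poly_Mapping.lookup d i\<bar> \<le> (\<Sum>i\<in>Poly_Mapping.keys d. nat \<bar>Poly_Mapping.lookup d i\<bar>)"
      by (rule member_le_sum) (use True in auto)
    then show ?thesis by linarith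
  next
    case False
    then have "Poly_Mapping.lookup d i = 0" by (simp add: in_keys_iff)
    then show ?thesis by linarith
  qed
  then have "expvec_bounded ?N d" using K unfolding expvec_bounded_def by fastforce
  then show ?thesis unfolding mmonom_def by (intro Abs_mlaurent_inverse) auto
qed

definition mvar :: "nat \<Rightarrow> 'a::comm_ring_1 mlaurent" where
  "mvar i = mmonom (Poly_Mapping.single i 1)"

definition const_term :: "'a::comm_ring_1 mlaurent \<Rightarrow> 'a" where
  "const_term f = mcoeff f 0"

lemma mcoeff_minus: "mcoeff (f - g) e = mcoeff f e - mcoeff g e"
  unfolding minus_mlaurent_def plus_mlaurent.rep_eq uminus_mlaurent.rep_eq by simp

lemma mcoeff_mmonom_times: "mcoeff (mmonom d * f) e = mcoeff f (e - d)"
proof -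
  have "mcoeff (mmonom d * f) e = (\<Sum>a\<in>{d}. mcoeff (mmonom d) a * mcoeff f (e - a))"
    by (rule mcoeff_times_superset) (auto simp: mcoeff_mmonom split: if_splits)
  then show ?thesis by (simp add: mcoeff_mmonom)
qed

lemma mmonom_mult: "mmonom d * mmonom d' = mmonom (d + d')"
  by (rule mlaurent_eqI) (auto simp: mcoeff_mmonom_times mcoeff_mmonom algebra_simps)

lemma mmonom_0: "mmonom 0 = 1"
  by (rule mlaurent_eqI) (simp add: mcoeff_mmonom one_mlaurent.rep_eq)

lemma inverse_mmonom: "inverse (mmonom d) = mmonom (- d)"
  by (rule mlaurent_inverse_unique) (simp add: mmonom_mult mmonom_0)

lemma mcoeff_inverse_one_minus_mmonom:
  fixes d e :: "nat \<Rightarrow>\<^sub>0 int"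
  assumes "d \<noteq> 0" and nonneg: "\<And>i. Poly_Mapping.lookup d i \<ge> 0"
  shows "mcoeff (inverse (1 - mmonom d)) e = (if \<exists>k. e = ((+) d ^^ k) 0 then 1 else (0::'a::comm_ring_1))"
proof -
  let ?G = "\<lambda>e. if \<exists>k. e = ((+) d ^^ k) 0 then 1 else (0::'a)"
  have lk: "Poly_Mapping.lookup (((+) d ^^ k) 0) i = int k * Poly_Mapping.lookup d i" for k i
    by (induction k) (simp_all add: lookup_add algebra_simps)
  obtain N where N: "Poly_Mapping.keys d \<subseteq> {..<N}"
    using finite_nat_set_iff_bounded[of "Poly_Mapping.keys d"] by auto
  have "expvec_bounded N (((+) d ^^ k) 0)" for k
    unfolding expvec_bounded_def
  proof (intro conjI allI)
    show "Poly_Mapping.keys (((+) d ^^ k) 0) \<subseteq> {..<N}"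
      using N by (auto simp: in_keys_iff lk subset_iff)
    show "- int N \<le> Poly_Mapping.lookup (((+) d ^^ k) 0) i" for i
      unfolding lk using mult_nonneg_nonneg[OF _ nonneg[of i], of "int k"] by linarith
  qed
  then have "?G \<in> {f. \<exists>N. \<forall>e. f e \<noteq> 0 \<longrightarrow> expvec_bounded N e}" by auto
  then have G: "mcoeff (Abs_mlaurent ?G) = ?G" by (rule Abs_mlaurent_inverse)
  have rec: "(\<exists>k. e = ((+) d ^^ k) 0) \<longleftrightarrow> e = 0 \<or> (\<exists>k. e - d = ((+) d ^^ k) 0)" for e
  proof -
    have "(\<exists>k. e = ((+) d ^^ k) 0) \<longleftrightarrow> e = 0 \<or> (\<exists>k. e = ((+) d ^^ Suc k) 0)"
    proof
      assume "\<exists>k. e = ((+) d ^^ k) 0"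
      then obtain k where "e = ((+) d ^^ k) 0" ..
      then show "e = 0 \<or> (\<exists>k. e = ((+) d ^^ Suc k) 0)" by (cases k) auto
    next
      assume "e = 0 \<or> (\<exists>k. e = ((+) d ^^ Suc k) 0)"
      then show "\<exists>k. e = ((+) d ^^ k) 0"
      proof (elim disjE exE)
        assume "e = 0"
        then show ?thesis by (intro exI[of _ 0]) simp
      qed (rule exI)
    qed
    also have "(\<exists>k. e = ((+) d ^^ Suc k) 0) \<longleftrightarrow> (\<exists>k. e - d = ((+) d ^^ k) 0)"
      by (simp only: diff_eq_eq funpow.simps comp_apply add.commute)
    finally show ?thesis .
  qed
  have neg: "- d \<noteq> ((+) d ^^ k) 0" for k
  proof
    assume eq: "- d = ((+) d ^^ k) 0"
    have "Poly_Mapping.lookup d i = 0" for i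
    proof -
      have "- Poly_Mapping.lookup d i = int k * Poly_Mapping.lookup d i"
        using arg_cong[OF eq, of "\<lambda>p. Poly_Mapping.lookup p i"] by (simp add: lk)
      then show ?thesis
        using nonneg[of i] mult_nonneg_nonneg[of "int k" "Poly_Mapping.lookup d i"] by linarith
    qed
    then show False using \<open>d \<noteq> 0\<close> by (auto intro: poly_mapping_eqI)
  qed
  have step: "?G e - ?G (e - d) = (if e = 0 then 1 else 0)" for e
  proof (cases "e = 0")
    case True
    have "\<exists>k. 0 = ((+) d ^^ k) 0" by (rule exI[of _ 0]) simp
    moreover have "\<not> (\<exists>k. 0 - d = ((+) d ^^ k) 0)" using neg by (simp only: diff_0) blast
    ultimately show ?thesis by (simp only: True refl if_True if_False diff_0_right)
  next
    case False
    then have "(\<exists>k. e = ((+) d ^^ k) 0) \<longleftrightarrow> (\<exists>k. e - d = ((+) d ^^ k) 0)"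
      using rec[of e] by blast
    then show ?thesis using False by (simp only: diff_self if_False)
  qed
  have "(1 - mmonom d) * Abs_mlaurent ?G = 1"
  proof (rule mlaurent_eqI)
    fix e
    have "mcoeff ((1 - mmonom d) * Abs_mlaurent ?G) e = ?G e - ?G (e - d)"
      by (simp only: left_diff_distrib mcoeff_minus mcoeff_mmonom_times G mult_1)
    also note step[of e]
    finally show "mcoeff ((1 - mmonom d) * Abs_mlaurent ?G) e = mcoeff 1 e"
      by (simp only: one_mlaurent.rep_eq)
  qed
  then have "inverse (1 - mmonom d) = Abs_mlaurent ?G" by (rule mlaurent_inverse_unique)
  then have "mcoeff (inverse (1 - mmonom d)) e = mcoeff (Abs_mlaurent ?G) e" by (rule arg_cong)
  also have "\<dots> = ?G e" by (rule fun_cong[OF G])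
  finally show ?thesis .
qed

end

theory Submission
  imports Defs
begin

text \<open>
  Write \<open>u\<^sub>i = 1/x\<^sub>i\<close> and \<open>s\<^sub>i\<^sub>j = (x\<^sub>i - x\<^sub>j) / (1 - x\<^sub>i x\<^sub>j)\<close>.  Since
  \<open>(1 - x\<^sub>i/x\<^sub>j)(1 - x\<^sub>j/x\<^sub>i) = (u\<^sub>i - u\<^sub>j)(x\<^sub>i - x\<^sub>j)\<close>, the integrand is the product of the symmetric factors
  \<open>(u\<^sub>i - u\<^sub>j) s\<^sub>i\<^sub>j\<close> over all pairs and of the weights \<open>(1 + u\<^sub>i)\<^sup>m / (1 - x\<^sub>i)\<close>.  Lagrange interpolation
  splits off one variable \<open>x\<^sub>z\<close> with a freely chosen polynomial \<open>P(u\<^sub>z)\<close> of degree \<open>n - 1\<close> in place of the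
  factors \<open>u\<^sub>z - u\<^sub>j\<close>.  Expanding the product of the \<open>s\<^sub>z\<^sub>j\<close> into partial fractions couples \<open>x\<^sub>z\<close> to a
  single further variable \<open>x\<^sub>k\<close>.  For \<open>P\<close> take \<open>1 - u\<close> times a Pade numerator: it is skew-orthogonal,
  with respect to the pairing of \<open>x\<^sub>z\<close> with \<open>x\<^sub>k\<close>, to all powers of \<open>u\<^sub>k\<close> that occur except the highest one,
  \<open>u\<^sub>k\<close> to the power \<open>n - 2\<close>.  So the constant term for \<open>n\<close> variables is an explicit multiple of that
  for \<open>n - 2\<close> variables.
\<close>

section \<open>Constant terms and units\<close>

definition involves_only :: "nat set \<Rightarrow> 'a::comm_ring_1 mlaurent \<Rightarrow> bool" where
  "involves_only K f \<longleftrightarrow> (\<forall>e. mcoeff f e \<noteq> 0 \<longrightarrow> Poly_Mapping.keys e \<subseteq> K)"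

lemma involves_only_mono: "involves_only K f \<Longrightarrow> K \<subseteq> K' \<Longrightarrow> involves_only K' f"
  unfolding involves_only_def by blast

lemma involves_only_0 [simp]: "involves_only K 0"
  by (simp add: involves_only_def zero_mlaurent.rep_eq)

lemma involves_only_1 [simp]: "involves_only K 1"
  by (simp add: involves_only_def one_mlaurent.rep_eq)

lemma involves_only_add [intro]:
  assumes "involves_only K f" "involves_only K g"
  shows "involves_only K (f + g)"
  using assms unfolding involves_only_def plus_mlaurent.rep_eq by (metis add.left_neutral)

lemma involves_only_uminus [intro]: "involves_only K f \<Longrightarrow> involves_only K (- f)"
  by (simp add: involves_only_def uminus_mlaurent.rep_eq)

lemma involves_only_diff [intro]:
  assumes "involves_only K f" "involves_only K g"
  shows "involves_only K (f - g)"
  unfolding minus_mlaurent_def using assms by blast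

lemma involves_only_mult [intro]:
  assumes "involves_only K f" "involves_only K g"
  shows "involves_only K (f * g)"
  unfolding involves_only_def
proof (intro allI impI)
  fix e assume "mcoeff (f * g) e \<noteq> 0"
  then obtain a where a: "mcoeff f a \<noteq> 0" "mcoeff g (e - a) \<noteq> 0"
    unfolding mcoeff_times by (auto elim: sum.not_neutral_contains_not_neutral)
  have "Poly_Mapping.keys e \<subseteq> Poly_Mapping.keys a \<union> Poly_Mapping.keys (e - a)"
    using Poly_Mapping.keys_add[of a "e - a"] by simp
  with a assms show "Poly_Mapping.keys e \<subseteq> K" unfolding involves_only_def by blast
qed

lemma involves_only_power [intro]: "involves_only K f \<Longrightarrow> involves_only K (f ^ m)"
  by (induction m) auto

lemma involves_only_sum [intro]:
  "(\<And>i. i \<in> S \<Longrightarrow> involves_only K (f i)) \<Longrightarrow> involves_only K (sum f S)"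
  by (induction S rule: infinite_finite_induct) auto

lemma involves_only_prod [intro]:
  "(\<And>i. i \<in> S \<Longrightarrow> involves_only K (f i)) \<Longrightarrow> involves_only K (prod f S)"
  by (induction S rule: infinite_finite_induct) auto

lemma involves_only_mmonom [intro]: "Poly_Mapping.keys d \<subseteq> K \<Longrightarrow> involves_only K (mmonom d)"
  by (auto simp: involves_only_def mcoeff_mmonom)

lemma involves_only_mvar [intro]: "i \<in> K \<Longrightarrow> involves_only K (mvar i)"
  unfolding mvar_def by (intro involves_only_mmonom) auto

lemma involves_only_inverse_mvar [intro]: "i \<in> K \<Longrightarrow> involves_only K (inverse (mvar i))"
  unfolding mvar_def inverse_mmonom by (intro involves_only_mmonom) auto

section \<open>Constant terms, inverse variables and geometric series\<close>

lemma const_term_add: "const_term (f + g) = const_term f + const_term g"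
  by (simp add: const_term_def plus_mlaurent.rep_eq)

lemma const_term_0 [simp]: "const_term 0 = 0"
  by (simp add: const_term_def zero_mlaurent.rep_eq)

lemma const_term_1 [simp]: "const_term 1 = 1"
  by (simp add: const_term_def one_mlaurent.rep_eq)

lemma const_term_sum: "const_term (sum f S) = (\<Sum>i\<in>S. const_term (f i))"
  by (induction S rule: infinite_finite_induct) (auto simp: const_term_add)

text \<open>Exponent vectors contributing to the constant term are opposite, hence have the same
  support. Disjointness forces both to be 0.\<close>

lemma const_term_mult_disjoint:
  assumes f: "involves_only I f" and g: "involves_only J g" and "I \<inter> J = {}"
  shows "const_term (f * g) = const_term f * const_term g"
proof -
  have "a = 0" if "mcoeff f a \<noteq> 0" "mcoeff g (0 - a) \<noteq> 0" for a
  proof -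
    have "Poly_Mapping.keys a \<subseteq> I" "Poly_Mapping.keys (- a) \<subseteq> J"
      using that f g unfolding involves_only_def by (fastforce, metis diff_0)
    moreover have "Poly_Mapping.keys (- a) = Poly_Mapping.keys a"
      by (auto simp: in_keys_iff)
    ultimately show ?thesis using \<open>I \<inter> J = {}\<close> by (metis Int_greatest keys_eq_empty subset_empty)
  qed
  then show ?thesis unfolding const_term_def
    by (subst mcoeff_times_superset[of "{0}"]) auto
qed

lemma mcoeff_of_int_mult: "mcoeff (of_int z * f) e = of_int z * mcoeff f e"
proof -
  have "mcoeff (of_nat n * f) e = of_nat n * mcoeff f e" for n
    by (induction n) (auto simp: distrib_right plus_mlaurent.rep_eq zero_mlaurent.rep_eq)
  then show ?thesis
    by (cases z rule: int_cases2) (auto simp: uminus_mlaurent.rep_eq)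
qed

lemma const_term_of_int_mult: "const_term (of_int z * f) = of_int z * const_term f"
  by (simp add: const_term_def mcoeff_of_int_mult)

lemma mvar_inverse: "mvar i * inverse (mvar i) = 1"
  unfolding mvar_def inverse_mmonom by (simp add: mmonom_mult mmonom_0)

lemma inverse_mvar_power: "inverse (mvar i) ^ k = mmonom (Poly_Mapping.single i (- int k))"
proof (induction k)
  case 0 then show ?case by (simp add: mmonom_0)
next
  case (Suc k)
  then show ?case
    by (simp add: mvar_def inverse_mmonom mmonom_mult single_uminus[symmetric] single_add[symmetric])
qed

lemma const_term_mmonom_mult: "const_term (mmonom d * f) = mcoeff f (- d)"
  by (simp add: const_term_def mcoeff_mmonom_times)

lemma inverse_mvar_diff_nonzerodivisor:
  assumes "i \<noteq> j" and eq: "(inverse (mvar i) - inverse (mvar j)) * f = 0"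
  shows "f = 0"
proof (rule ccontr)
  assume "f \<noteq> 0"
  then obtain e where e: "mcoeff f e \<noteq> 0"
    by (metis mlaurent_eqI zero_mlaurent.rep_eq)
  define d :: "nat \<Rightarrow>\<^sub>0 int" where "d = Poly_Mapping.single i 1 - Poly_Mapping.single j 1"
  have "mcoeff f (a + Poly_Mapping.single i 1) = mcoeff f (a + Poly_Mapping.single j 1)" for a
  proof -
    have "mcoeff ((inverse (mvar i) - inverse (mvar j)) * f) a = 0"
      using eq by (simp add: zero_mlaurent.rep_eq)
    then show ?thesis
      by (simp add: left_diff_distrib mcoeff_minus mvar_def inverse_mmonom mcoeff_mmonom_times)
  qed
  from this[of "_ - Poly_Mapping.single j 1"] have step: "mcoeff f (a + d) = mcoeff f a" for a
    by (simp add: d_def algebra_simps)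
  \<comment> \<open>The coefficients of \<open>f\<close> are constant along \<open>e + k d\<close>, which leaves every region bounded below.\<close>
  have "mcoeff f (((+) d ^^ k) e) = mcoeff f e" for k
    by (induction k) (simp_all add: step add.commute[of d])
  moreover have "Poly_Mapping.lookup (((+) d ^^ k) e) j = Poly_Mapping.lookup e j - int k" for k
    using \<open>i \<noteq> j\<close> by (induction k) (auto simp: lookup_add lookup_minus d_def lookup_single)
  moreover obtain N where "\<And>a. mcoeff f a \<noteq> 0 \<Longrightarrow> expvec_bounded N a"
    using mcoeff_bounded[of f] by blast
  ultimately have "- int N \<le> Poly_Mapping.lookup e j - int k" for k
    using e unfolding expvec_bounded_def by metis
  from this[of "nat (Poly_Mapping.lookup e j) + N + 1"] show False by linarith
qed

text \<open>\<open>inverse\<close> is 0 on non-units. The known coefficient 1 at exponent 0 excludes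
  this default value, so a true inverse exists.\<close>

lemma inverse_geometric:
  fixes d :: "nat \<Rightarrow>\<^sub>0 int"
  assumes "d \<noteq> 0" "\<And>i. Poly_Mapping.lookup d i \<ge> 0"
  shows "(1 - mmonom d) * inverse (1 - mmonom d) = (1 :: 'a::comm_ring_1 mlaurent)"
proof -
  let ?h = "inverse (1 - mmonom d) :: 'a mlaurent"
  show ?thesis
  proof (cases "?h = 0")
    case True
    have "mcoeff ?h 0 = 1"
      unfolding mcoeff_inverse_one_minus_mmonom[OF assms] by (auto intro: exI[of _ 0])
    with True show ?thesis by (simp add: zero_mlaurent.rep_eq)
  next
    case False
    then have "\<exists>g. (1 - mmonom d) * g = (1 :: 'a mlaurent)"
      unfolding inverse_mlaurent_def by (auto split: if_splits)
    then show ?thesis using mlaurent_inverse_unique by metis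
  qed
qed

lemma involves_only_inverse_geometric:
  fixes d :: "nat \<Rightarrow>\<^sub>0 int"
  assumes "d \<noteq> 0" "\<And>i. Poly_Mapping.lookup d i \<ge> 0" "Poly_Mapping.keys d \<subseteq> K"
  shows "involves_only K (inverse (1 - mmonom d) :: 'a::comm_ring_1 mlaurent)"
proof -
  have lk: "Poly_Mapping.lookup (((+) d ^^ k) 0) i = int k * Poly_Mapping.lookup d i" for k i
    by (induction k) (simp_all add: lookup_add algebra_simps)
  have "Poly_Mapping.keys (((+) d ^^ k) 0) \<subseteq> K" for k
    using assms(3) by (auto simp: in_keys_iff lk)
  then show ?thesis
    unfolding involves_only_def mcoeff_inverse_one_minus_mmonom[OF assms(1,2)] by auto
qed

section \<open>The pair product and Lagrange interpolation\<close>

abbreviation minv :: "nat \<Rightarrow> 'a::comm_ring_1 mlaurent" where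
  "minv i \<equiv> inverse (mvar i)"

definition geom :: "nat \<Rightarrow> nat \<Rightarrow> 'a::comm_ring_1 mlaurent" where
  "geom i j = inverse (1 - mvar i * mvar j)"

text \<open>The hypotheses of the geometric series lemmas for the monomial x_i x_j;
  \<open>i = j\<close> is allowed.\<close>

lemma pair_exponent:
  fixes i j :: nat
  defines "d \<equiv> Poly_Mapping.single i 1 + Poly_Mapping.single j (1::int)"
  shows "mvar i * mvar j = mmonom d" "d \<noteq> 0" "Poly_Mapping.lookup d k \<ge> 0"
    "Poly_Mapping.keys d \<subseteq> {i, j}"
proof -
  show "mvar i * mvar j = mmonom d" by (simp add: d_def mvar_def mmonom_mult)
  have "Poly_Mapping.lookup d i \<noteq> 0" by (simp add: d_def lookup_add lookup_single when_def)
  then show "d \<noteq> 0" by auto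
  show "Poly_Mapping.lookup d k \<ge> 0" by (simp add: d_def lookup_add lookup_single when_def)
  show "Poly_Mapping.keys d \<subseteq> {i, j}"
    by (auto simp: d_def in_keys_iff lookup_add lookup_single when_def split: if_splits)
qed

lemma geom_mult: "(1 - mvar i * mvar j) * geom i j = 1"
  unfolding geom_def pair_exponent(1) by (intro inverse_geometric pair_exponent)

lemma involves_only_geom [intro]: "i \<in> K \<Longrightarrow> j \<in> K \<Longrightarrow> involves_only K (geom i j)"
  unfolding geom_def pair_exponent(1)
  by (rule involves_only_inverse_geometric) (use pair_exponent[of i j] in auto)

lemma geom_commute: "geom i j = geom j i"
  by (simp add: geom_def mult.commute)

text \<open>The s_ij of the overview.\<close>

definition kern :: "nat \<Rightarrow> nat \<Rightarrow> 'a::comm_ring_1 mlaurent" where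
  "kern i j = (mvar i - mvar j) * geom i j"

text \<open>Both factors are antisymmetric, so the product does not depend on the order of the
  pair.\<close>

definition pairk :: "nat \<Rightarrow> nat \<Rightarrow> 'a::comm_ring_1 mlaurent" where
  "pairk i j = (minv i - minv j) * kern i j"

lemma kern_antisym: "kern j i = - kern i j"
  by (simp add: kern_def geom_commute[of j] algebra_simps)

lemma pairk_commute: "pairk i j = pairk j i"
  by (simp add: pairk_def kern_antisym[of j] algebra_simps)

definition pairprod :: "nat set \<Rightarrow> 'a::comm_ring_1 mlaurent" where
  "pairprod K = (\<Prod>(i, j) \<in> {(i, j). i \<in> K \<and> j \<in> K \<and> i < j}. pairk i j)"

lemma involves_only_kern [intro]: "i \<in> K \<Longrightarrow> j \<in> K \<Longrightarrow> involves_only K (kern i j)"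
  unfolding kern_def by blast

lemma involves_only_pairk [intro]: "i \<in> K \<Longrightarrow> j \<in> K \<Longrightarrow> involves_only K (pairk i j)"
  unfolding pairk_def by blast

lemma involves_only_pairprod [intro]: "involves_only K (pairprod K)"
  unfolding pairprod_def by (rule involves_only_prod) auto

lemma pairprod_empty [simp]: "pairprod {} = 1"
  by (simp add: pairprod_def)

text \<open>The new pairs have \<open>w\<close> either as smaller or as larger index; by symmetry of
  \<open>pairk\<close> both kinds contribute \<open>pairk w j\<close>.\<close>

lemma pairprod_insert:
  assumes "finite K" "w \<notin> K"
  shows "pairprod (insert w K) = (\<Prod>j\<in>K. pairk w j) * pairprod K"
proof -
  let ?P = "\<lambda>K. {(i, j). i \<in> K \<and> j \<in> K \<and> i < (j::nat)}"
  let ?A = "(\<lambda>j. (w, j)) ` {j\<in>K. w < j}" and ?B = "(\<lambda>j. (j, w)) ` {j\<in>K. j < w}"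
  have fin: "finite (?P K)" by (rule finite_subset[of _ "K \<times> K"]) (use assms in auto)
  have "?P (insert w K) = (?A \<union> ?B) \<union> ?P K" by auto
  then have "pairprod (insert w K) = (\<Prod>(i, j)\<in>?A \<union> ?B. pairk i j) * pairprod K"
    unfolding pairprod_def by (simp only:) (rule prod.union_disjoint, use assms fin in auto)
  also have "(\<Prod>(i, j)\<in>?A \<union> ?B. pairk i j)
      = (\<Prod>(i, j)\<in>?A. pairk i j) * ((\<Prod>(i, j)\<in>?B. pairk i j) :: 'a mlaurent)"
    by (rule prod.union_disjoint) (use assms in auto)
  also have "(\<Prod>(i, j)\<in>?A. pairk i j) = ((\<Prod>j | j \<in> K \<and> w < j. pairk w j) :: 'a mlaurent)"
    by (subst prod.reindex) (auto intro: inj_onI)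
  also have "(\<Prod>(i, j)\<in>?B. pairk i j) = ((\<Prod>j | j \<in> K \<and> j < w. pairk w j) :: 'a mlaurent)"
    by (subst prod.reindex) (auto intro: inj_onI simp: pairk_commute[of _ w])
  also have "(\<Prod>j | j \<in> K \<and> w < j. pairk w j) * (\<Prod>j | j \<in> K \<and> j < w. pairk w j)
      = ((\<Prod>j\<in>K. pairk w j) :: 'a mlaurent)"
  proof -
    have "K = {j. j \<in> K \<and> w < j} \<union> {j. j \<in> K \<and> j < w}"
      using assms by (auto intro: le_neq_trans simp: not_less)
    moreover have "prod (pairk w) ({j. j \<in> K \<and> w < j} \<union> {j. j \<in> K \<and> j < w})
        = (\<Prod>j | j \<in> K \<and> w < j. pairk w j) * ((\<Prod>j | j \<in> K \<and> j < w. pairk w j) :: 'a mlaurent)"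
      by (rule prod.union_disjoint) (use assms in auto)
    ultimately show ?thesis by simp
  qed
  finally show ?thesis .
qed

lemma pairprod_singleton [simp]: "pairprod {i} = 1"
  using pairprod_insert[of "{}" i] by simp

lemma pairprod_remove:
  assumes "finite K" "w \<in> K"
  shows "pairprod K = (\<Prod>j\<in>K - {w}. pairk w j) * pairprod (K - {w})"
  using pairprod_insert[of "K - {w}" w] assms by (simp add: insert_absorb)

text \<open>
  \<open>lagrange_sum j K = pairprod K * (\<Sum>k\<in>K. u\<^sub>k\<^sup>j / (\<Prod>l\<in>K - {k}. u\<^sub>k - u\<^sub>l))\<close> where \<open>u\<^sub>k = 1/x\<^sub>k\<close>; the
  differences \<open>u\<^sub>k - u\<^sub>l\<close> are not units of the ring, so they are cancelled against \<open>pairprod\<close>.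
\<close>

definition lagrange_sum :: "nat \<Rightarrow> nat set \<Rightarrow> 'a::comm_ring_1 mlaurent" where
  "lagrange_sum j K = (\<Sum>k\<in>K. minv k ^ j * (\<Prod>l\<in>K - {k}. kern k l) * pairprod (K - {k}))"

text \<open>Write u_k = u_w + (u_k - u_w). The second part vanishes at k = w; elsewhere u_k - u_w
  completes \<open>kern k w\<close> to \<open>pairk k w\<close>, which removes the node
  \<open>w\<close>.\<close>

lemma lagrange_sum_Suc:
  assumes "finite K" "w \<in> K"
  shows "lagrange_sum (Suc j) K
    = minv w * lagrange_sum j K + (\<Prod>l\<in>K - {w}. pairk w l) * lagrange_sum j (K - {w})"
proof -
  define t :: "nat \<Rightarrow> 'a mlaurent" where
    "t k = (minv k - minv w) * (minv k ^ j * (\<Prod>l\<in>K - {k}. kern k l) * pairprod (K - {k}))" for k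
  have "lagrange_sum (Suc j) K - minv w * lagrange_sum j K = (\<Sum>k\<in>K. t k)"
    by (simp add: lagrange_sum_def t_def sum_distrib_left algebra_simps flip: sum_subtractf)
  also have "\<dots> = (\<Sum>k\<in>K - {w}. t k)"
    using assms by (simp add: sum.remove[of K w] t_def)
  also have "\<dots> = (\<Sum>k\<in>K - {w}. (\<Prod>l\<in>K - {w}. pairk w l)
      * (minv k ^ j * (\<Prod>l\<in>K - {w} - {k}. kern k l) * pairprod (K - {w} - {k})))"
  proof (rule sum.cong[OF refl])
    fix k assume k: "k \<in> K - {w}"
    let ?R = "K - {w} - {k}"
    have R: "K - {k} = insert w ?R" "w \<notin> ?R" "finite ?R" "K - {w} = insert k ?R" "k \<notin> ?R"
      using k assms by auto
    have "t k = (minv k - minv w) * (minv k ^ j * (kern k w * (\<Prod>l\<in>?R. kern k l))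
        * ((\<Prod>l\<in>?R. pairk w l) * pairprod ?R))"
      unfolding t_def R(1) pairprod_insert[OF R(3,2)] prod.insert[OF R(3,2)] by simp
    also have "\<dots> = (pairk w k * (\<Prod>l\<in>?R. pairk w l))
        * (minv k ^ j * (\<Prod>l\<in>?R. kern k l) * pairprod ?R)"
      unfolding pairk_commute[of w k] pairk_def[of k w] by (simp add: mult_ac)
    also have "pairk w k * (\<Prod>l\<in>?R. pairk w l) = (\<Prod>l\<in>K - {w}. pairk w l)"
      by (subst R(4), subst prod.insert[OF R(3,5)]) simp
    finally show "t k = (\<Prod>l\<in>K - {w}. pairk w l)
      * (minv k ^ j * (\<Prod>l\<in>?R. kern k l) * pairprod ?R)" .
  qed
  also have "\<dots> = (\<Prod>l\<in>K - {w}. pairk w l) * lagrange_sum j (K - {w})"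
    by (simp add: lagrange_sum_def sum_distrib_left)
  finally show ?thesis by (simp add: algebra_simps)
qed

text \<open>Removing either of two nodes w, w' leaves a sum that is 0 by induction, so u_w and u_w'
  times the sum both equal \<open>lagrange_sum 1 K\<close>. Their difference is not a zero divisor.
  For two nodes, antisymmetry of \<open>kern\<close> suffices.\<close>

lemma lagrange_sum_0: "finite K \<Longrightarrow> card K \<ge> 2 \<Longrightarrow> lagrange_sum 0 K = 0"
proof (induction "card K" arbitrary: K)
  case (Suc n)
  show ?case
  proof (cases "card K = 2")
    case True
    then obtain a b where "K = {a, b}" "a \<noteq> b" by (auto simp: card_2_iff)
    then show ?thesis
      by (simp add: lagrange_sum_def insert_Diff_if kern_antisym[of a b])
  next
    case False
    have z: "lagrange_sum 0 (K - {w}) = (0 :: 'a mlaurent)" if "w \<in> K" for w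
      by (rule Suc.hyps(1)) (use that Suc.prems Suc.hyps(2) False in auto)
    obtain w where w: "w \<in> K" using Suc.prems by fastforce
    have "card (K - {w}) \<noteq> 0" using Suc.prems w by simp
    then have "K - {w} \<noteq> {}" by force
    then obtain w' where w': "w' \<in> K" "w \<noteq> w'" by blast
    have "lagrange_sum 1 K = minv v * (lagrange_sum 0 K :: 'a mlaurent)" if "v \<in> K" for v
      using lagrange_sum_Suc[OF Suc.prems(1) that, of 0, where ?'a = 'a] z[OF that] by simp
    from this[OF w, symmetric] this[OF w'(1)]
    have "minv w * lagrange_sum 0 K = minv w' * (lagrange_sum 0 K :: 'a mlaurent)" by (rule trans)
    then have "(minv w - minv w') * (lagrange_sum 0 K :: 'a mlaurent) = 0" by (simp add: left_diff_distrib)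
    with w'(2) show ?thesis by (rule inverse_mvar_diff_nonzerodivisor)
  qed
qed auto

text \<open>The divided difference of t^j at the nodes u_k, times \<open>pairprod K\<close>. One use
  of \<open>lagrange_sum_Suc\<close> lowers the power and the number of nodes together.\<close>

lemma lagrange_sum_eq:
  "finite K \<Longrightarrow> j < card K \<Longrightarrow> lagrange_sum j K = (if Suc j = card K then pairprod K else 0)"
proof (induction j arbitrary: K)
  case 0
  show ?case
  proof (cases "card K = 1")
    case True
    then obtain a where "K = {a}" by (auto simp: card_1_singleton_iff)
    then show ?thesis by (simp add: lagrange_sum_def)
  next
    case False then show ?thesis using 0 lagrange_sum_0[of K] by simp
  qed
next
  case (Suc j)
  then obtain w where w: "w \<in> K" by fastforce
  have "lagrange_sum j K = (0 :: 'a mlaurent)" using Suc by simp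
  moreover have "lagrange_sum j (K - {w})
      = (if Suc j = card (K - {w}) then pairprod (K - {w}) else (0 :: 'a mlaurent))"
    by (rule Suc.IH) (use Suc.prems w in auto)
  moreover have "Suc j = card (K - {w}) \<longleftrightarrow> Suc (Suc j) = card K"
    using Suc.prems w by auto
  ultimately show ?case
    using lagrange_sum_Suc[OF Suc.prems(1) w, of j, where ?'a = 'a]
      pairprod_remove[OF Suc.prems(1) w, where ?'a = 'a] by simp
qed

section \<open>Partial fractions\<close>

text \<open>With t = a/b and s(x, y) = (x - y) / (1 - x y), this is the addition law of tanh, s(t,w)
  s(t,k) s(w,k) = s(w,k) + s(t,w) - s(t,k), cleared of denominators. Both differences of products in
  the proof contain the factor a^2 - b^2.\<close>

lemma kern_three_term:
  fixes a b :: "'a::comm_ring_1 mlaurent"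
  defines "\<alpha> \<equiv> \<lambda>j. a - b * mvar j" and "\<beta> \<equiv> \<lambda>j. b - a * mvar j"
  shows "\<alpha> w * \<alpha> k * kern w k = \<beta> w * \<beta> k * kern w k + \<alpha> w * \<beta> k - \<alpha> k * \<beta> w"
proof -
  have "(\<alpha> w * \<alpha> k - \<beta> w * \<beta> k) * (mvar w - mvar k)
      = (\<alpha> w * \<beta> k - \<alpha> k * \<beta> w) * (1 - mvar w * mvar k)"
    unfolding \<alpha>_def \<beta>_def by (simp add: algebra_simps)
  then have "(\<alpha> w * \<alpha> k - \<beta> w * \<beta> k) * kern w k
      = (\<alpha> w * \<beta> k - \<alpha> k * \<beta> w) * ((1 - mvar w * mvar k) * geom w k)"
    unfolding kern_def mult.assoc[symmetric] by (rule arg_cong)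
  then show ?thesis unfolding geom_mult by (simp add: algebra_simps)
qed

text \<open>The ring computation for the insertion step below: \<open>aw\<close>, \<open>ak\<close>,
  \<open>bw\<close>, \<open>bk\<close> are the values of \<alpha> and \<beta>, \<open>s\<close> is
  \<open>kern w k\<close>, and \<open>q\<close>, \<open>b\<close>, \<open>d\<close>,
  \<open>p\<close> are the products over \<open>K - {k}\<close> of \<open>pairk w\<close> and
  \<beta>, then \<open>inv_diffs K k\<close> and \<open>pairprod (K - {k})\<close>.\<close>

lemma three_term_expand:
  fixes s :: "'a::comm_ring_1"
  shows "(bw * bk * s + aw * bk - ak * bw) * ((uw - uk) * q * b * (d * p))
    = bw * (bk * b) * ((uw - uk) * s * q * (d * p)) + aw * (bk * b) * ((uw - uk) * q * (d * p))
      + ak * (bw * b) * ((uk - uw) * d * (q * p))"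
  by (simp add: algebra_simps)

definition inv_diffs :: "nat set \<Rightarrow> nat \<Rightarrow> 'a::comm_ring_1 mlaurent" where
  "inv_diffs K k = (\<Prod>j\<in>K - {k}. minv k - minv j)"

text \<open>
  Partial fractions in \<open>a/b\<close> of \<open>\<Prod>j\<in>K. (a - b x\<^sub>j) / (b - a x\<^sub>j)\<close>, whose residue at \<open>1/x\<^sub>k\<close> is
  proportional to \<open>\<Prod>j\<in>K - {k}. (1 - x\<^sub>k x\<^sub>j) / (x\<^sub>k - x\<^sub>j)\<close>.  The homogeneous form is needed in the
  induction, which uses the identity for \<open>K\<close> at the point \<open>1/x\<^sub>w\<close> to insert \<open>w\<close>.
\<close>

lemma kern_partial_fractions_homogeneous:
  assumes "finite K"
  shows "\<exists>C :: 'a::comm_ring_1 mlaurent. involves_only K C \<and> (\<forall>a b.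
    (\<Prod>j\<in>K. a - b * mvar j) * pairprod K = C * (\<Prod>j\<in>K. b - a * mvar j)
      + (\<Sum>k\<in>K. (a - b * mvar k) * (\<Prod>j\<in>K - {k}. b - a * mvar j)
          * (inv_diffs K k * pairprod (K - {k}))))"
  using assms
proof (induction K)
  case empty
  show ?case by (intro exI[of _ 1]) simp
next
  case (insert w K)
  let ?L = "insert w K"
  let ?D = "\<lambda>k. inv_diffs K k * pairprod (K - {k}) :: 'a mlaurent"
  let ?q = "\<lambda>S. \<Prod>j\<in>S. pairk w j :: 'a mlaurent"
  from insert.IH obtain C :: "'a mlaurent" where C: "involves_only K C"
    and eq: "\<And>a b. (\<Prod>j\<in>K. a - b * mvar j) * pairprod K = C * (\<Prod>j\<in>K. b - a * mvar j)
      + (\<Sum>k\<in>K. (a - b * mvar k) * (\<Prod>j\<in>K - {k}. b - a * mvar j) * ?D k)"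
    by blast
  have rem: "(\<Prod>j\<in>K. f j) = f k * (\<Prod>j\<in>K - {k}. f j)" if "k \<in> K" for k and f :: "nat \<Rightarrow> 'a mlaurent"
    using prod.remove[OF insert.hyps(1) that] .
  \<comment> \<open>The hypothesis at \<open>a = 1\<close>, \<open>b = mvar w\<close>, times
    \<open>?m K\<close>, which turns each 1 - x_w x_j into u_w - u_j and each x_w - x_j into
    \<open>pairk w j\<close>. The left side is the coefficient required at the new pole
    1/x_w.\<close>
  have special: "(\<Prod>j\<in>K. minv w - minv j) * pairprod K
      = C * ?q K + (\<Sum>k\<in>K. (minv w - minv k) * ?q (K - {k}) * ?D k)"
  proof -
    let ?m = "\<lambda>S. \<Prod>j\<in>S. (minv w - minv j) * geom w j :: 'a mlaurent"
    have one: "(\<Prod>j\<in>K. 1 - mvar w * mvar j) * ?m K = (\<Prod>j\<in>K. minv w - minv j)"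
    proof -
      have "(1 - mvar w * mvar j) * ((minv w - minv j) * geom w j) = (minv w - minv j :: 'a mlaurent)" for j
        by (subst mult.left_commute) (simp add: geom_mult)
      then show ?thesis by (simp flip: prod.distrib)
    qed
    have q: "(\<Prod>j\<in>S. mvar w - mvar j) * ?m S = ?q S" for S
      by (simp add: pairk_def kern_def mult_ac flip: prod.distrib)
    have "(\<Prod>j\<in>K. minv w - minv j) * pairprod K
        = ((\<Prod>j\<in>K. 1 - mvar w * mvar j) * pairprod K) * ?m K"
      by (simp add: mult_ac flip: one)
    also have "\<dots> = C * ?q K + (\<Sum>k\<in>K. (1 - mvar w * mvar k)
        * (\<Prod>j\<in>K - {k}. mvar w - mvar j) * ?D k * ?m K)"
      unfolding eq[of 1 "mvar w"] by (simp add: distrib_right sum_distrib_right mult.assoc q)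
    also have "(\<Sum>k\<in>K. (1 - mvar w * mvar k) * (\<Prod>j\<in>K - {k}. mvar w - mvar j) * ?D k * ?m K)
        = (\<Sum>k\<in>K. (minv w - minv k) * ?q (K - {k}) * ?D k)"
    proof (rule sum.cong[OF refl])
      fix k assume "k \<in> K"
      then have m: "?m K = (minv w - minv k) * geom w k * ?m (K - {k})" by (rule rem)
      have "(1 - mvar w * mvar k) * (\<Prod>j\<in>K - {k}. mvar w - mvar j) * ?D k * ?m K
          = ((1 - mvar w * mvar k) * geom w k) * (minv w - minv k)
            * ((\<Prod>j\<in>K - {k}. mvar w - mvar j) * ?m (K - {k})) * ?D k"
        unfolding m by (simp only: mult_ac)
      then show "(1 - mvar w * mvar k) * (\<Prod>j\<in>K - {k}. mvar w - mvar j) * ?D k * ?m K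
          = (minv w - minv k) * ?q (K - {k}) * ?D k"
        unfolding geom_mult q by simp
    qed
    finally show ?thesis .
  qed
  \<comment> \<open>The new constant collects the \<beta>\<beta> parts of the three-term identity.
    The old \<open>C\<close> and the terms with \<open>?\<alpha> w * ?B\<close> combine, by
    \<open>special\<close>, into the summand of the pole 1/x_w.\<close>
  define C' where "C' = ?q K * (\<Sum>k\<in>K. ?D k)"
  have "involves_only ?L C'"
    unfolding C'_def inv_diffs_def
    by (intro involves_only_mult involves_only_prod involves_only_sum involves_only_pairk
        involves_only_diff involves_only_inverse_mvar involves_only_mono[OF involves_only_pairprod]) auto
  moreover have "(\<Prod>j\<in>?L. a - b * mvar j) * pairprod ?L = C' * (\<Prod>j\<in>?L. b - a * mvar j)
      + (\<Sum>k\<in>?L. (a - b * mvar k) * (\<Prod>j\<in>?L - {k}. b - a * mvar j)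
          * (inv_diffs ?L k * pairprod (?L - {k})))" for a b :: "'a mlaurent"
  proof -
    let ?\<alpha> = "\<lambda>j. a - b * mvar j" and ?\<beta> = "\<lambda>j. b - a * mvar j"
    let ?B = "\<Prod>j\<in>K. ?\<beta> j"
    let ?new = "\<lambda>k. ?\<alpha> k * (?\<beta> w * (\<Prod>j\<in>K - {k}. ?\<beta> j))
          * ((minv k - minv w) * inv_diffs K k * (?q (K - {k}) * pairprod (K - {k})))"
    have "(\<Prod>j\<in>?L. ?\<alpha> j) * pairprod ?L = ?\<alpha> w * ?q K * ((\<Prod>j\<in>K. ?\<alpha> j) * pairprod K)"
      by (simp add: pairprod_insert insert.hyps mult_ac)
    also have "\<dots> = ?\<alpha> w * ?q K * C * ?B
        + (\<Sum>k\<in>K. ?\<alpha> w * ?q K * (?\<alpha> k * (\<Prod>j\<in>K - {k}. ?\<beta> j) * ?D k))"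
      unfolding eq by (simp add: distrib_left sum_distrib_left mult.assoc)
    also have "(\<Sum>k\<in>K. ?\<alpha> w * ?q K * (?\<alpha> k * (\<Prod>j\<in>K - {k}. ?\<beta> j) * ?D k))
        = (\<Sum>k\<in>K. ?\<beta> w * ?B * (?q K * ?D k)
            + ?\<alpha> w * ?B * ((minv w - minv k) * ?q (K - {k}) * ?D k) + ?new k)"
    proof (rule sum.cong[OF refl])
      fix k assume k: "k \<in> K"
      note K = rem[OF k, of ?\<beta>] rem[OF k, of "pairk w"]
      have "?\<alpha> w * ?q K * (?\<alpha> k * (\<Prod>j\<in>K - {k}. ?\<beta> j) * ?D k)
          = (?\<alpha> w * ?\<alpha> k * kern w k) * ((minv w - minv k) * ?q (K - {k}) * (\<Prod>j\<in>K - {k}. ?\<beta> j) * ?D k)"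
        unfolding K(2) pairk_def[of w k] by (simp only: mult_ac)
      also have "\<dots> = ?\<beta> w * (?\<beta> k * (\<Prod>j\<in>K - {k}. ?\<beta> j)) * (((minv w - minv k) * kern w k) * ?q (K - {k}) * ?D k)
            + ?\<alpha> w * (?\<beta> k * (\<Prod>j\<in>K - {k}. ?\<beta> j)) * ((minv w - minv k) * ?q (K - {k}) * ?D k) + ?new k"
        by (subst kern_three_term) (rule three_term_expand)
      finally show "?\<alpha> w * ?q K * (?\<alpha> k * (\<Prod>j\<in>K - {k}. ?\<beta> j) * ?D k)
          = ?\<beta> w * ?B * (?q K * ?D k) + ?\<alpha> w * ?B * ((minv w - minv k) * ?q (K - {k}) * ?D k) + ?new k"
        unfolding K pairk_def[of w k] by simp
    qed
    also have "?\<alpha> w * ?q K * C * ?B + \<dots> = C' * (?\<beta> w * ?B)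
        + ?\<alpha> w * ?B * ((\<Prod>j\<in>K. minv w - minv j) * pairprod K) + (\<Sum>k\<in>K. ?new k)"
      unfolding special C'_def
      by (simp add: sum.distrib sum_distrib_left sum_distrib_right distrib_left mult_ac)
    also have "(\<Sum>k\<in>K. ?new k) = (\<Sum>k\<in>K. ?\<alpha> k * (\<Prod>j\<in>?L - {k}. ?\<beta> j)
        * (inv_diffs ?L k * pairprod (?L - {k})))"
    proof (rule sum.cong[OF refl])
      fix k assume k: "k \<in> K"
      then have L: "?L - {k} = insert w (K - {k})" "w \<notin> K - {k}" "finite (K - {k})"
        using insert.hyps by auto
      show "?new k = ?\<alpha> k * (\<Prod>j\<in>?L - {k}. ?\<beta> j) * (inv_diffs ?L k * pairprod (?L - {k}))"
        unfolding inv_diffs_def L(1) pairprod_insert[OF L(3,2)] prod.insert[OF L(3,2)] ..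
    qed
    finally show ?thesis
      using insert.hyps by (simp add: inv_diffs_def add.assoc mult.assoc)
  qed
  ultimately show ?case by blast
qed

text \<open>The homogeneous identity at \<open>a = mvar z\<close>, \<open>b = 1\<close>, divided by
  all 1 - x_z x_j. The constant is chosen before \<open>z\<close>, and is free of x_z if
  \<open>z\<close> lies outside \<open>K\<close>.\<close>

lemma kern_partial_fractions:
  assumes "finite K"
  shows "\<exists>C :: 'a::comm_ring_1 mlaurent. involves_only K C \<and> (\<forall>z.
    (\<Prod>j\<in>K. kern z j) * pairprod K
      = C + (\<Sum>k\<in>K. kern z k * inv_diffs K k * pairprod (K - {k})))"
proof -
  let ?D = "\<lambda>k. inv_diffs K k * pairprod (K - {k}) :: 'a mlaurent"
  obtain C :: "'a mlaurent" where C: "involves_only K C"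
    and eq: "\<And>a b. (\<Prod>j\<in>K. a - b * mvar j) * pairprod K = C * (\<Prod>j\<in>K. b - a * mvar j)
      + (\<Sum>k\<in>K. (a - b * mvar k) * (\<Prod>j\<in>K - {k}. b - a * mvar j) * ?D k)"
    using kern_partial_fractions_homogeneous[OF assms, where ?'a = 'a] by blast
  have "(\<Prod>j\<in>K. kern z j) * pairprod K = C + (\<Sum>k\<in>K. kern z k * ?D k)" for z
  proof -
    let ?g = "\<lambda>S. \<Prod>j\<in>S. geom z j :: 'a mlaurent"
    have g: "(\<Prod>j\<in>S. 1 - mvar z * mvar j) * ?g S = 1" for S
      by (simp add: geom_mult flip: prod.distrib)
    have "(\<Prod>j\<in>K. kern z j) * pairprod K = (\<Prod>j\<in>K. mvar z - 1 * mvar j) * pairprod K * ?g K"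
      by (simp add: kern_def mult_ac prod.distrib)
    also have "\<dots> = C + (\<Sum>k\<in>K. (mvar z - mvar k) * (\<Prod>j\<in>K - {k}. 1 - mvar z * mvar j) * ?D k * ?g K)"
      unfolding eq by (simp add: distrib_right sum_distrib_right mult.assoc g)
    also have "(\<Sum>k\<in>K. (mvar z - mvar k) * (\<Prod>j\<in>K - {k}. 1 - mvar z * mvar j) * ?D k * ?g K)
        = (\<Sum>k\<in>K. kern z k * ?D k)"
    proof (rule sum.cong[OF refl])
      fix k assume k: "k \<in> K"
      have "(mvar z - mvar k) * (\<Prod>j\<in>K - {k}. 1 - mvar z * mvar j) * ?D k * ?g K
          = kern z k * ?D k * ((\<Prod>j\<in>K - {k}. 1 - mvar z * mvar j) * ?g (K - {k}))"
        unfolding prod.remove[OF assms k, of "geom z"] kern_def by (simp only: mult_ac)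
      then show "(mvar z - mvar k) * (\<Prod>j\<in>K - {k}. 1 - mvar z * mvar j) * ?D k * ?g K
          = kern z k * ?D k" unfolding g by simp
    qed
    finally show ?thesis .
  qed
  with C show ?thesis by (auto simp: mult.assoc)
qed

section \<open>Alternating binomial sums\<close>

text \<open>The iterated difference (1 - E)^L f at 0, where E is the shift by one.\<close>

definition alt_sum :: "nat \<Rightarrow> (nat \<Rightarrow> rat) \<Rightarrow> rat" where
  "alt_sum L f = (\<Sum>l\<le>L. (-1) ^ l * of_nat (L choose l) * f l)"

lemma alt_sum_0 [simp]: "alt_sum 0 f = f 0"
  by (simp add: alt_sum_def)

lemma alt_sum_cong: "(\<And>l. l \<le> L \<Longrightarrow> f l = g l) \<Longrightarrow> alt_sum L f = alt_sum L g"
  by (simp add: alt_sum_def)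

lemma alt_sum_add: "alt_sum L (\<lambda>l. f l + g l) = alt_sum L f + alt_sum L g"
  by (simp add: alt_sum_def distrib_left sum.distrib)

lemma alt_sum_mult: "alt_sum L (\<lambda>l. c * f l) = c * alt_sum L f"
  by (simp add: alt_sum_def sum_distrib_left mult_ac)

lemma alt_sum_Suc: "alt_sum (Suc L) f = alt_sum L f - alt_sum L (\<lambda>l. f (Suc l))"
proof -
  have "alt_sum (Suc L) f
      = f 0 + (\<Sum>l\<le>L. (-1) ^ Suc l * of_nat (Suc L choose Suc l) * f (Suc l))"
    unfolding alt_sum_def by (subst sum.atMost_Suc_shift) simp
  also have "(\<Sum>l\<le>L. (-1) ^ Suc l * of_nat (Suc L choose Suc l) * f (Suc l))
      = (\<Sum>l\<le>L. (-1) ^ Suc l * of_nat (L choose Suc l) * f (Suc l)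
          - (-1) ^ l * of_nat (L choose l) * f (Suc l))"
    by (rule sum.cong) (simp_all add: algebra_simps)
  also have "\<dots> = (\<Sum>l\<le>L. (-1) ^ Suc l * of_nat (L choose Suc l) * f (Suc l))
      - alt_sum L (\<lambda>l. f (Suc l))"
    by (simp only: sum_subtractf alt_sum_def)
  also have "f 0 + \<dots> = (\<Sum>l\<le>Suc L. (-1) ^ l * of_nat (L choose l) * f l)
      - alt_sum L (\<lambda>l. f (Suc l))"
    by (subst sum.atMost_Suc_shift) simp
  also have "(\<Sum>l\<le>Suc L. (-1) ^ l * of_nat (L choose l) * f l) = alt_sum L f"
    by (simp add: alt_sum_def)
  finally show ?thesis .
qed

lemma alt_sum_times_index:
  "alt_sum (Suc L) (\<lambda>l. of_nat l * f l) = - of_nat (Suc L) * alt_sum L (\<lambda>l. f (Suc l))"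
proof -
  have "alt_sum (Suc L) (\<lambda>l. of_nat l * f l)
      = (\<Sum>l\<le>L. (-1) ^ Suc l * (of_nat (Suc l) * of_nat (Suc L choose Suc l)) * f (Suc l))"
    unfolding alt_sum_def by (subst sum.atMost_Suc_shift) (simp add: mult_ac)
  also have "\<dots> = (\<Sum>l\<le>L. - of_nat (Suc L) * ((-1) ^ l * of_nat (L choose l) * f (Suc l)))"
    unfolding of_nat_mult[symmetric] Suc_times_binomial
    by (rule sum.cong) (simp_all add: algebra_simps)
  finally show ?thesis unfolding alt_sum_def sum_distrib_left .
qed

text \<open>L differences annihilate a polynomial of degree k < L. The index in the last factor is
  absorbed into the binomial coefficient, lowering both L and the degree.\<close>

lemma alt_sum_prod_eq_0:
  "k < L \<Longrightarrow> alt_sum L (\<lambda>l. \<Prod>s<k. of_nat l + c s) = 0"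
proof (induction k arbitrary: L c)
  case 0
  then obtain L' where "L = Suc L'" by (cases L) auto
  then show ?case by (simp add: alt_sum_Suc)
next
  case (Suc k)
  then obtain L' where L: "L = Suc L'" "k < L'" by (cases L) auto
  let ?f = "\<lambda>l. \<Prod>s<k. of_nat l + c s"
  have "alt_sum L (\<lambda>l. \<Prod>s<Suc k. of_nat l + c s)
      = alt_sum L (\<lambda>l. of_nat l * ?f l + c k * ?f l)"
    by (simp add: algebra_simps)
  also have "\<dots> = - of_nat L * alt_sum L' (\<lambda>l. ?f (Suc l)) + c k * alt_sum L ?f"
    unfolding alt_sum_add alt_sum_mult L(1) alt_sum_times_index ..
  also have "alt_sum L' (\<lambda>l. ?f (Suc l)) = 0"
    using Suc.IH[OF L(2), of "\<lambda>s. 1 + c s"] by (simp add: algebra_simps)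
  also have "alt_sum L ?f = 0" by (rule Suc.IH) (use Suc.prems in simp)
  finally show ?case by simp
qed

text \<open>A partial fraction expansion in \<open>a\<close>. The Pascal step
  \<open>alt_sum_Suc\<close> subtracts the case \<open>a + 1\<close> from the case
  \<open>a\<close>.\<close>

lemma alt_sum_reciprocal:
  "(\<And>l. l \<le> L \<Longrightarrow> of_nat l + a \<noteq> 0) \<Longrightarrow>
    alt_sum L (\<lambda>l. 1 / (of_nat l + a)) = fact L / (\<Prod>s\<le>L. of_nat s + a)"
proof (induction L arbitrary: a)
  case (Suc L)
  have nz: "of_nat l + a \<noteq> 0" if "l \<le> Suc L" for l using Suc.prems that by blast
  have nz': "of_nat l + (a + 1) \<noteq> 0" if "l \<le> L" for l
    using nz[of "Suc l"] that by (simp add: algebra_simps)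
  let ?P = "\<Prod>s<L. of_nat (Suc s) + a"
  have P: "(\<Prod>s\<le>L. of_nat s + a) = a * ?P"
    by (subst lessThan_Suc_atMost[symmetric], subst prod.lessThan_Suc_shift) simp
  have P': "(\<Prod>s\<le>L. of_nat s + (a + 1)) = ?P * (of_nat (Suc L) + a)"
    by (subst lessThan_Suc_atMost[symmetric]) (simp add: algebra_simps)
  have P'': "(\<Prod>s\<le>Suc L. of_nat s + a) = a * ?P * (of_nat (Suc L) + a)"
    by (simp add: P)
  have "?P \<noteq> 0" "a \<noteq> 0" "of_nat (Suc L) + a \<noteq> 0"
    using nz[of "Suc _"] nz[of 0] nz[of "Suc L"] by auto
  moreover have "alt_sum (Suc L) (\<lambda>l. 1 / (of_nat l + a))
      = fact L / (a * ?P) - fact L / (?P * (of_nat (Suc L) + a))"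
    unfolding alt_sum_Suc using Suc.IH[of a] Suc.IH[of "a + 1"] nz nz' P P'
    by (simp add: algebra_simps)
  ultimately show ?case unfolding P'' by (simp add: divide_simps) (simp add: algebra_simps)
qed simp

text \<open>Divide the numerator by l + a. The quotient has degree below L and is annihilated; the
  remainder is the numerator at l = -a.\<close>

lemma alt_sum_prod_over_linear:
  assumes "\<And>l. l \<le> L \<Longrightarrow> of_nat l + a \<noteq> 0" "k \<le> L"
  shows "alt_sum L (\<lambda>l. (\<Prod>s<k. of_nat l + c s) / (of_nat l + a))
    = (\<Prod>s<k. c s - a) * fact L / (\<Prod>s\<le>L. of_nat s + a)"
  using assms(2)
proof (induction k)
  case 0
  show ?case using alt_sum_reciprocal[OF assms(1)] by simp
next
  case (Suc k)
  let ?f = "\<lambda>l. \<Prod>s<k. of_nat l + c s"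
  have "alt_sum L (\<lambda>l. (\<Prod>s<Suc k. of_nat l + c s) / (of_nat l + a))
      = alt_sum L (\<lambda>l. ?f l + (c k - a) * (?f l / (of_nat l + a)))"
  proof (rule alt_sum_cong)
    fix l assume "l \<le> L"
    then have "of_nat l + a \<noteq> 0" by (rule assms(1))
    then have "(of_nat l + c k) / (of_nat l + a) = 1 + (c k - a) / (of_nat l + a)"
      by (simp add: divide_simps)
    then have "?f l * ((of_nat l + c k) / (of_nat l + a)) = ?f l * (1 + (c k - a) / (of_nat l + a))"
      by simp
    then show "(\<Prod>s<Suc k. of_nat l + c s) / (of_nat l + a)
        = ?f l + (c k - a) * (?f l / (of_nat l + a))"
      by (simp add: distrib_left mult_ac)
  qed
  also have "\<dots> = (c k - a) * alt_sum L (\<lambda>l. ?f l / (of_nat l + a))"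
    unfolding alt_sum_add alt_sum_mult using alt_sum_prod_eq_0[of k L c] Suc.prems by simp
  finally show ?case using Suc by simp
qed

section \<open>Falling factorials and the Pade numerator\<close>

lemma prod_lessThan_add:
  fixes i k :: nat
  shows "(\<Prod>s<i + k. g s) = (\<Prod>s<i. g s) * (\<Prod>s<k. g (i + s) :: 'a::comm_monoid_mult)"
  by (induction k) (simp_all add: mult.assoc)

lemma prod_falling: "(\<Prod>s<k. of_nat n - of_nat s) = (fact k * of_nat (n choose k) :: rat)"
  by (simp add: binomial_gbinomial gbinomial_prod_rev atLeast0LessThan)

lemma prod_falling_fact:
  "(\<Prod>s<k. of_nat n - of_nat s) = (if k \<le> n then fact n / fact (n - k) else 0 :: rat)"
  unfolding prod_falling by (auto simp: binomial_fact binomial_eq_0)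

text \<open>
  \<open>\<Sum>l\<le>L. pade_coeff m L l * u\<^sup>l\<close> is, up to a factor, the numerator of a Pade approximant of
  \<open>(1 + u)\<close> to the power \<open>- (2 * m + 1)\<close>: multiplied by \<open>(1 + u)\<close> to the power \<open>2 * m + 1\<close>, its coefficients
  at the exponents \<open>m, \<dots>, m + L - 1\<close> vanish.  For \<open>m = 0\<close> and \<open>l = L\<close> the truncated subtraction in
  the second binomial coefficient yields \<open>0 choose 0 = 1\<close>, as it should.
\<close>

definition pade_coeff :: "nat \<Rightarrow> nat \<Rightarrow> nat \<Rightarrow> int" where
  "pade_coeff m L l = (-1) ^ l * int ((m + 1 + l choose l) * (m + (L - l) - 1 choose (L - l)))"

lemma pade_coeff_last: "pade_coeff m L L = (-1) ^ L * int (m + 1 + L choose L)"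
  by (simp add: pade_coeff_def)

text \<open>The coefficient of u^r in u^l (1 + u)^N. The guard keeps truncated subtraction from
  yielding 1 for \<open>l > r\<close>.\<close>

definition shifted_binomial :: "nat \<Rightarrow> nat \<Rightarrow> nat \<Rightarrow> nat" where
  "shifted_binomial N r l = (if l \<le> r then N choose (r - l) else 0)"

text \<open>Brings the summand into the form of \<open>alt_sum\<close>: all factorials free of
  \<open>l\<close> move to the front. Where a factorial would have a negative argument, both sides
  are 0.\<close>

lemma pade_coeff_eq:
  assumes "m \<ge> 1" "l \<le> L"
  shows "of_int (pade_coeff m L l) * of_nat (shifted_binomial (2 * m + 1) (i + m) l)
    = fact (2 * m + 1) / (fact (m + 1) * fact (m - 1) * fact L)
      * ((-1) ^ l * of_nat (L choose l) * ((\<Prod>s<i. of_nat (m + 1 + l) - of_nat s)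
        * (if l \<le> i + m then fact (m + (L - l) - 1) / fact (i + m - l) else 0 :: rat)))"
proof (cases "l \<le> i + m \<and> i \<le> m + 1 + l")
  case True
  have "m + (L - l) - 1 - (L - l) = m - 1" "2 * m + 1 - (i + m - l) = m + 1 + l - i"
    "i + m - l \<le> 2 * m + 1" "L - l \<le> m + (L - l) - 1"
    using True assms by auto
  then show ?thesis
    using True assms unfolding pade_coeff_def shifted_binomial_def prod_falling_fact
    by (simp add: binomial_fact[where ?'a = rat] divide_simps)
next
  case False
  then show ?thesis
    unfolding prod_falling_fact by (auto simp: shifted_binomial_def binomial_eq_0)
qed

text \<open>The left side is the coefficient of u^(i+m) in the Pade numerator times (1 + u)^(2m+1).
  Apart from the binomial (L choose l), its summand is polynomial in l of degree L - 1 for i < L,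
  hence annihilated; for i = L it has a single pole, and its residue gives the value.\<close>

lemma pade_sum:
  assumes "i \<le> L"
  shows "(\<Sum>l\<le>L. pade_coeff m L l * int (shifted_binomial (2 * m + 1) (i + m) l))
    = (if i = L then (-1) ^ L * int (2 * m + 1 + L choose (m + 1)) else 0)" (is "?S = ?R")
proof (cases "m = 0")
  case True
  \<comment> \<open>The second binomial coefficient is
    \<open>L - l - 1 choose (L - l)\<close>.\<close>
  have "pade_coeff 0 L l = 0" if "l < L" for l
    using that by (simp add: pade_coeff_def binomial_eq_0)
  then have "?S = (\<Sum>l\<in>{L}. pade_coeff m L l * int (shifted_binomial (2 * m + 1) (i + m) l))"
    using True by (intro sum.mono_neutral_right) auto
  then show ?thesis using True assms
    by (auto simp: shifted_binomial_def pade_coeff_last)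
next
  case False
  define c where "c = (fact (2 * m + 1) / (fact (m + 1) * fact (m - 1) * fact L) :: rat)"
  define f where "f l = (if l \<le> i + m then fact (m + (L - l) - 1) / fact (i + m - l) else 0 :: rat)" for l
  have S: "of_int ?S = c * alt_sum L (\<lambda>l. (\<Prod>s<i. of_nat (m + 1 + l) - of_nat s) * f l)"
    unfolding of_int_sum alt_sum_def sum_distrib_left
  proof (rule sum.cong[OF refl])
    fix l assume "l \<in> {..L}"
    then show "of_int (pade_coeff m L l * int (shifted_binomial (2 * m + 1) (i + m) l))
      = c * ((- 1) ^ l * of_nat (L choose l) * ((\<Prod>s<i. of_nat (m + 1 + l) - of_nat s) * f l))"
      using pade_coeff_eq[of m l L i] False unfolding c_def f_def by simp
  qed
  have "of_int ?S = (of_int ?R :: rat)"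
  proof (cases "i = L")
    case False
    \<comment> \<open>The quotient of factorials in \<open>f\<close> is a falling factorial of
      length \<open>k\<close>; for \<open>l > i + m\<close> that product contains the factor 0, in
      agreement with \<open>f\<close>. The total degree is i + k = L - 1.\<close>
    define k where "k = L - 1 - i"
    have f: "f l = (\<Prod>s<k. of_nat (m + (L - l) - 1) - of_nat s)" if "l \<le> L" for l
    proof -
      have "k \<le> m + (L - l) - 1 \<longleftrightarrow> l \<le> i + m" "m + (L - l) - 1 - k = i + m - l"
        using that assms \<open>i \<noteq> L\<close> \<open>m \<noteq> 0\<close> by (auto simp: k_def)
      then show ?thesis unfolding prod_falling_fact f_def by simp
    qed
    have "alt_sum L (\<lambda>l. (\<Prod>s<i. of_nat (m + 1 + l) - of_nat s) * f l)
        = alt_sum L (\<lambda>l. (-1) ^ k * (\<Prod>s<i + k. of_nat l +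
            (if s < i then of_nat (m + 1) - of_nat s else of_nat (s - i) + 1 - of_nat (m + L))))"
    proof (rule alt_sum_cong)
      fix l assume l: "l \<le> L"
      have "f l = (\<Prod>s<k. - (of_nat l + (of_nat s + 1 - of_nat (m + L))))"
        unfolding f[OF l] using l \<open>m \<noteq> 0\<close> by (intro prod.cong) auto
      also have "\<dots> = (-1) ^ k * (\<Prod>s<k. of_nat l + (of_nat s + 1 - of_nat (m + L)))"
        by (subst prod_uminus) simp
      finally show "(\<Prod>s<i. of_nat (m + 1 + l) - of_nat s) * f l
        = (-1) ^ k * (\<Prod>s<i + k. of_nat l +
            (if s < i then of_nat (m + 1) - of_nat s else of_nat (s - i) + 1 - of_nat (m + L)))"
        unfolding prod_lessThan_add by (simp add: algebra_simps)
    qed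
    also have "\<dots> = 0"
      unfolding alt_sum_mult by (subst alt_sum_prod_eq_0) (use assms False in \<open>auto simp: k_def\<close>)
    finally have "of_int ?S = c * 0" unfolding S by (rule arg_cong)
    then show ?thesis using False by (simp only: mult_zero_right if_False of_int_0)
  next
    case True
    \<comment> \<open>For i = L the quotient is 1 / (m + L - l), with its pole at l = m + L.\<close>
    define a :: rat where "a = - of_nat (m + L)"
    have a: "of_nat l + a \<noteq> 0" if "l \<le> L" for l
      using that False by (simp add: a_def flip: of_nat_add)
    have "(\<Prod>s<L. of_nat (m + 1) - of_nat s - a) = (\<Prod>s<L. of_nat (2 * m + 1 + L) - of_nat s)"
      by (simp add: a_def algebra_simps)
    then have num: "(\<Prod>s<L. of_nat (m + 1) - of_nat s - a) = fact (2 * m + 1 + L) / fact (2 * m + 1)"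
      unfolding prod_falling_fact by simp
    have "(\<Prod>s\<le>L. of_nat s + a) = (\<Prod>s<Suc L. - 1 * (of_nat (m + L) - of_nat s))"
      by (auto simp: a_def lessThan_Suc_atMost intro!: prod.cong)
    also have "\<dots> = (-1) ^ Suc L * (\<Prod>s<Suc L. of_nat (m + L) - of_nat s)"
      unfolding prod.distrib by simp
    also have "\<dots> = - ((-1) ^ L * (fact (m + L) / fact (m - 1)))"
      unfolding prod_falling_fact using False by simp
    finally have den: "(\<Prod>s\<le>L. of_nat s + a) = - ((-1) ^ L * (fact (m + L) / fact (m - 1)))" .
    have lin: "alt_sum L (\<lambda>l. (\<Prod>s<L. of_nat l + (of_nat (m + 1) - of_nat s)) / (of_nat l + a))
        = (\<Prod>s<L. of_nat (m + 1) - of_nat s - a) * fact L / (\<Prod>s\<le>L. of_nat s + a)"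
      by (rule alt_sum_prod_over_linear[OF a order.refl])
    have "alt_sum L (\<lambda>l. (\<Prod>s<i. of_nat (m + 1 + l) - of_nat s) * f l)
        = alt_sum L (\<lambda>l. - 1 * ((\<Prod>s<L. of_nat l + (of_nat (m + 1) - of_nat s)) / (of_nat l + a)))"
    proof (rule alt_sum_cong)
      fix l assume l: "l \<le> L"
      then obtain t where t: "m + (L - l) = Suc t" "m + L - l = Suc t" "of_nat l + a = - of_nat (Suc t)"
        using False by (cases "m + (L - l)") (auto simp: a_def)
      have "f l = - (1 / (of_nat l + a))"
        unfolding t(3) minus_divide_right[symmetric] minus_minus
        using l t(1,2) True by (simp add: f_def add.commute)
      then show "(\<Prod>s<i. of_nat (m + 1 + l) - of_nat s) * f l
          = - 1 * ((\<Prod>s<L. of_nat l + (of_nat (m + 1) - of_nat s)) / (of_nat l + a))"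
        using True by (simp add: algebra_simps)
    qed
    also have "\<dots> = (-1) ^ L * (fact (2 * m + 1 + L) * fact L * fact (m - 1)
        / (fact (2 * m + 1) * fact (m + L)))"
      unfolding alt_sum_mult lin num den by (cases "even L") simp_all
    finally have "of_int ?S = c * ((-1) ^ L * (fact (2 * m + 1 + L) * fact L * fact (m - 1)
        / (fact (2 * m + 1) * fact (m + L))))"
      unfolding S by (rule arg_cong)
    also have "\<dots> = (-1) ^ L * (fact (2 * m + 1 + L) / (fact (m + 1) * fact (m + L)) :: rat)"
      unfolding c_def by (simp del: fact_Suc add: field_simps)
    also have "\<dots> = (-1) ^ L * of_nat (2 * m + 1 + L choose (m + 1))"
      by (subst binomial_fact) (simp_all add: mult_2 del: fact_Suc)
    finally show ?thesis
      unfolding if_P[OF True] of_int_mult of_int_power of_int_of_nat_eq of_int_minus of_int_1 .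
  qed
  then show ?thesis by (simp only: of_int_eq_iff)
qed

text \<open>The numerators 2i + L and 2i + L + 1 of the two new rows interleave to all integers from
  L + 2 to L + 2m + 1, so the two rows together form a quotient of factorials.\<close>

lemma product_ratio:
  fixes m :: nat and R :: "nat \<Rightarrow> rat"
  defines "R \<equiv> \<lambda>n. \<Prod>j<n. \<Prod>i = 1..m. of_nat (2 * i + j) / of_nat (i + j)"
  shows "R (L + 2) * of_nat (m + 1 + L choose L) = of_nat (2 * m + 1 + L choose (m + 1)) * R L"
proof -
  let ?A = "\<lambda>L. \<Prod>i = 1..m. of_nat (2 * i + L) / of_nat (i + L) :: rat"
  have "?A L * ?A (Suc L) = fact (2 * m + 1 + L) * fact L / (fact (m + L) * fact (m + 1 + L))"
  proof (induction m)
    case (Suc m)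
    let ?x = "of_nat (2 * Suc m + L) / of_nat (Suc m + L) :: rat"
      and ?y = "of_nat (2 * Suc m + Suc L) / of_nat (Suc m + Suc L) :: rat"
    have "(\<Prod>i = 1..Suc m. of_nat (2 * i + L) / of_nat (i + L))
        * (\<Prod>i = 1..Suc m. of_nat (2 * i + Suc L) / of_nat (i + Suc L))
        = fact (2 * m + 1 + L) * fact L / (fact (m + L) * fact (m + 1 + L)) * (?x * ?y)"
      unfolding Suc[symmetric] by (simp add: prod.nat_ivl_Suc' mult_ac add_ac)
    also have "\<dots> = (of_nat (2 * Suc m + Suc L) * (of_nat (2 * Suc m + L) * fact (2 * m + 1 + L))) * fact L
        / ((of_nat (Suc m + L) * fact (m + L)) * (of_nat (Suc m + Suc L) * fact (m + 1 + L)))"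
      by (simp only: times_divide_times_eq times_divide_eq_left times_divide_eq_right
          divide_divide_eq_left mult_ac)
    also have "of_nat (2 * Suc m + Suc L) * (of_nat (2 * Suc m + L) * fact (2 * m + 1 + L))
        = (fact (2 * Suc m + 1 + L) :: rat)"
      by (simp add: algebra_simps)
    also have "of_nat (Suc m + L) * fact (m + L) = (fact (Suc m + L) :: rat)" by simp
    also have "of_nat (Suc m + Suc L) * fact (m + 1 + L) = (fact (Suc m + 1 + L) :: rat)" by simp
    finally show ?case .
  qed simp
  moreover have "of_nat (m + 1 + L choose L) = (fact (m + 1 + L) / (fact L * fact (m + 1)) :: rat)"
    by (subst binomial_fact) (simp_all del: fact_Suc)
  moreover have "of_nat (2 * m + 1 + L choose (m + 1))
      = (fact (2 * m + 1 + L) / (fact (m + 1) * fact (m + L)) :: rat)"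
    by (subst binomial_fact) (simp_all add: mult_2 del: fact_Suc)
  ultimately have "?A L * ?A (Suc L) * of_nat (m + 1 + L choose L)
      = of_nat (2 * m + 1 + L choose (m + 1))"
    by (simp del: fact_Suc)
  moreover have "R (L + 2) = R L * (?A L * ?A (Suc L))"
    unfolding R_def add_2_eq_Suc' prod.lessThan_Suc by (simp only: mult.assoc)
  ultimately show ?thesis by (simp add: mult_ac)
qed

section \<open>The recursion from n to n - 2 variables\<close>

lemma const_term_minv_power: "const_term (minv y ^ a) = (if a = 0 then 1 else 0 :: 'a::comm_ring_1)"
proof -
  have "Poly_Mapping.single y (- int a) = 0 \<longleftrightarrow> a = 0"
    by (metis lookup_single_eq lookup_zero neg_equal_0_iff_equal of_nat_eq_0_iff single_zero)
  then show ?thesis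
    unfolding const_term_def inverse_mvar_power mcoeff_mmonom by (simp only: eq_commute[of 0])
qed

text \<open>\<open>geom y z\<close> is the sum of all x_y^k x_z^k, so only equal inverse powers are
  matched.\<close>

lemma const_term_minv_powers_geom:
  assumes "y \<noteq> z"
  shows "const_term (minv y ^ a * (minv z ^ b * geom y z)) = (if a = b then 1 else 0 :: 'a::comm_ring_1)"
proof -
  let ?d = "Poly_Mapping.single y 1 + Poly_Mapping.single z (1::int)"
  let ?e = "Poly_Mapping.single y (int a) + Poly_Mapping.single z (int b)"
  have lk: "Poly_Mapping.lookup (((+) ?d ^^ k) 0) i = int k * Poly_Mapping.lookup ?d i" for k i
    by (induction k) (simp_all add: lookup_add algebra_simps)
  have pow: "((+) ?d ^^ k) 0 = Poly_Mapping.single y (int k) + Poly_Mapping.single z (int k)" for k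
    by (rule poly_mapping_eqI, subst lk) (simp add: lookup_add lookup_single when_def)
  have "(\<exists>k. ?e = ((+) ?d ^^ k) 0) \<longleftrightarrow> a = b"
  proof
    assume "\<exists>k. ?e = ((+) ?d ^^ k) 0"
    then obtain k where k: "?e = Poly_Mapping.single y (int k) + Poly_Mapping.single z (int k)"
      unfolding pow by blast
    have "Poly_Mapping.lookup ?e i = (if i = y then int k else 0) + (if i = z then int k else 0)" for i
      unfolding k by (simp add: lookup_add lookup_single when_def)
    from this[of y] this[of z] show "a = b"
      using assms by (simp add: lookup_add lookup_single when_def)
  qed (auto simp: pow)
  moreover have "const_term (minv y ^ a * (minv z ^ b * geom y z)) = mcoeff (geom y z :: 'a mlaurent) ?e"
    by (simp add: inverse_mvar_power const_term_mmonom_mult mcoeff_mmonom_times single_uminus add.commute)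
  moreover have "mcoeff (geom y z :: 'a mlaurent) ?e = (if \<exists>k. ?e = ((+) ?d ^^ k) 0 then 1 else 0)"
    unfolding geom_def pair_exponent(1)
    by (rule mcoeff_inverse_one_minus_mmonom) (rule pair_exponent)+
  ultimately show ?thesis by simp
qed

lemma one_plus_minv_power:
  "(1 + minv y) ^ A = (\<Sum>a\<le>A. of_int (int (A choose a)) * (minv y ^ a :: 'a::comm_ring_1 mlaurent))"
  using binomial_ring[of "minv y" "1 :: 'a mlaurent" A] by (simp add: add.commute)

lemma const_term_binomial_shift:
  "const_term ((1 + minv y) ^ A * minv y ^ l) = (if l = 0 then 1 else 0 :: 'a::comm_ring_1)"
proof -
  have "const_term ((1 + minv y) ^ A * minv y ^ l :: 'a mlaurent)
      = (\<Sum>a\<le>A. of_int (int (A choose a)) * const_term (minv y ^ (a + l)))"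
    unfolding one_plus_minv_power sum_distrib_right const_term_sum
    by (simp only: mult.assoc const_term_of_int_mult power_add)
  also have "\<dots> = (\<Sum>a\<in>{0}. of_int (int (A choose a)) * const_term (minv y ^ (a + l)))"
    by (rule sum.mono_neutral_right) (auto simp: const_term_minv_power)
  finally show ?thesis by (simp add: const_term_minv_power)
qed

lemma const_term_binomials_geom:
  assumes "y \<noteq> z"
  shows "const_term ((1 + minv y) ^ A * minv y ^ l * ((1 + minv z) ^ B * minv z ^ i * geom y z))
    = (of_nat (shifted_binomial (A + B) (i + B) l) :: 'a::comm_ring_1)"
proof -
  have "const_term ((1 + minv y) ^ A * minv y ^ l * ((1 + minv z) ^ B * minv z ^ i * geom y z) :: 'a mlaurent)
      = const_term (\<Sum>b\<le>B. \<Sum>a\<le>A. of_int (int (B choose b)) * (of_int (int (A choose a))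
          * (minv y ^ (a + l) * (minv z ^ (b + i) * geom y z))))"
    unfolding one_plus_minv_power sum_distrib_left sum_distrib_right power_add
    by (simp only: mult_ac)
  also have "\<dots> = (\<Sum>b\<le>B. \<Sum>a\<le>A. of_nat (B choose b) * (of_nat (A choose a) * (if a + l = b + i then 1 else 0)))"
    unfolding const_term_sum const_term_of_int_mult const_term_minv_powers_geom[OF assms] by simp
  also have "\<dots> = (\<Sum>b\<le>B. of_nat ((B choose b) * shifted_binomial A (b + i) l))"
  proof (rule sum.cong[OF refl])
    fix b
    have "(\<Sum>a\<le>A. of_nat (A choose a) * (if a + l = b + i then 1 else 0))
        = (of_nat (shifted_binomial A (b + i) l) :: 'a)"
    proof (cases "l \<le> b + i \<and> b + i - l \<le> A")
      case True
      then have "(\<Sum>a\<le>A. of_nat (A choose a) * (if a + l = b + i then 1 else 0 :: 'a))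
          = (\<Sum>a\<in>{b + i - l}. of_nat (A choose a) * (if a + l = b + i then 1 else 0))"
        by (intro sum.mono_neutral_right) auto
      then show ?thesis using True by (simp add: shifted_binomial_def)
    next
      case False
      then have "(\<Sum>a\<le>A. of_nat (A choose a) * (if a + l = b + i then 1 else 0 :: 'a)) = 0"
        by (intro sum.neutral) auto
      then show ?thesis using False by (auto simp: shifted_binomial_def binomial_eq_0)
    qed
    then show "(\<Sum>a\<le>A. of_nat (B choose b) * (of_nat (A choose a) * (if a + l = b + i then 1 else 0)))
        = (of_nat ((B choose b) * shifted_binomial A (b + i) l) :: 'a)"
      by (simp flip: sum_distrib_left)
  qed
  also have "\<dots> = of_nat (\<Sum>b\<le>B. (B choose b) * shifted_binomial A (b + i) l)" by simp
  \<comment> \<open>Reversing \<open>b\<close> makes the lower indices add up to a constant, as the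
    Vandermonde convolution requires.\<close>
  also have "(\<Sum>b\<le>B. (B choose b) * shifted_binomial A (b + i) l)
      = (\<Sum>b\<le>B. (B choose b) * shifted_binomial A (i + B - b) l)"
    by (rule sum.reindex_bij_witness[of _ "\<lambda>b. B - b" "\<lambda>b. B - b"])
      (auto simp: binomial_symmetric[symmetric] add.commute)
  also have "\<dots> = shifted_binomial (A + B) (i + B) l"
  proof (cases "l \<le> i + B")
    case True
    define r where "r = i + B - l"
    have "(\<Sum>b\<le>B. (B choose b) * shifted_binomial A (i + B - b) l)
        = (\<Sum>b\<le>B. (B choose b) * (if b \<le> r then A choose (r - b) else 0))"
      using True by (intro sum.cong) (auto simp: shifted_binomial_def r_def add.commute)
    also have "\<dots> = (\<Sum>b\<le>max B r. (B choose b) * (if b \<le> r then A choose (r - b) else 0))"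
      by (rule sum.mono_neutral_left) auto
    also have "\<dots> = (\<Sum>b\<le>r. (B choose b) * (A choose (r - b)))"
      by (rule sum.mono_neutral_cong_right) auto
    also have "\<dots> = (B + A) choose r" by (rule vandermonde)
    finally show ?thesis using True by (simp add: shifted_binomial_def r_def add.commute)
  next
    case False
    then show ?thesis by (auto simp: shifted_binomial_def intro!: sum.neutral)
  qed
  finally show ?thesis .
qed

section \<open>Weights and the skew-orthogonal factor\<close>

lemma mvar_geometric: "(1 - mvar i) * inverse (1 - mvar i) = (1 :: 'a::comm_ring_1 mlaurent)"
  unfolding mvar_def by (rule inverse_geometric) (auto simp: lookup_single when_def)

lemma involves_only_inverse_one_minus_mvar [intro]:
  "i \<in> K \<Longrightarrow> involves_only K (inverse (1 - mvar i) :: 'a::comm_ring_1 mlaurent)"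
  unfolding mvar_def by (rule involves_only_inverse_geometric) (auto simp: lookup_single when_def)

definition weight :: "nat \<Rightarrow> nat \<Rightarrow> 'a::comm_ring_1 mlaurent" where
  "weight m i = (1 + minv i) ^ m * inverse (1 - mvar i)"

lemma involves_only_weight [intro]: "i \<in> K \<Longrightarrow> involves_only K (weight m i)"
  unfolding weight_def by (intro involves_only_mult involves_only_power involves_only_add) auto

text \<open>Up to sign, P(u_z) times \<open>weight m z\<close> for the P of the overview, with the
  pole at x_z = 1 cancelled by the factor 1 - u_z.\<close>

definition pade_factor :: "nat \<Rightarrow> nat \<Rightarrow> nat \<Rightarrow> 'a::comm_ring_1 mlaurent" where
  "pade_factor m L z
    = minv z * (1 + minv z) ^ m * (\<Sum>l\<le>L. of_int (pade_coeff m L l) * minv z ^ l)"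

lemma pade_factor_eq:
  "pade_factor m L z
    = (\<Sum>l\<le>L. of_int (pade_coeff m L l) * ((1 + minv z) ^ m * minv z ^ Suc l))"
  unfolding pade_factor_def sum_distrib_left by (rule sum.cong) (simp_all add: mult_ac)

lemma involves_only_of_int [intro]: "involves_only K (of_int c :: 'a::comm_ring_1 mlaurent)"
proof -
  have "involves_only K (of_nat k :: 'a mlaurent)" for k by (induction k) auto
  then show ?thesis by (cases c rule: int_cases2) auto
qed

lemma involves_only_pade_factor [intro]: "z \<in> K \<Longrightarrow> involves_only K (pade_factor m L z)"
  unfolding pade_factor_def
  by (intro involves_only_mult involves_only_power involves_only_add involves_only_sum) auto

text \<open>The factor \<open>minv z\<close> leaves only negative powers of x_z. Hence terms free of
  x_z are killed by \<open>pade_factor\<close>.\<close>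

lemma const_term_pade_factor: "const_term (pade_factor m L z) = 0"
  unfolding pade_factor_eq const_term_sum const_term_of_int_mult const_term_binomial_shift by simp

lemma weight_factor: "(1 - minv z) * weight m z = - (minv z * (1 + minv z) ^ m)"
proof -
  have "1 - minv z = - (minv z * (1 - mvar z) :: 'a mlaurent)"
    using mvar_inverse[of z, where ?'a = 'a] by (simp add: algebra_simps)
  then have "(1 - minv z) * weight m z
      = - (minv z * (1 + minv z) ^ m) * ((1 - mvar z) * inverse (1 - mvar z) :: 'a mlaurent)"
    unfolding weight_def by (simp add: mult_ac)
  then show ?thesis unfolding mvar_geometric by simp
qed

text \<open>Partial fractions in x_z. The last summand is free of x_y, and so is killed by
  \<open>pade_factor m L y\<close>.\<close>

lemma kern_times_geometric:
  "kern y z * inverse (1 - mvar z) = (1 + mvar y) * geom y z - inverse (1 - mvar z)"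
proof -
  let ?x = "mvar y :: 'a mlaurent" and ?y = "mvar z :: 'a mlaurent"
  let ?g = "geom y z :: 'a mlaurent" and ?h = "inverse (1 - ?y)"
  have "(1 + ?x) * ?g - ?h = (1 + ?x) * ?g * ((1 - ?y) * ?h) - ?h * ((1 - ?x * ?y) * ?g)"
    by (simp add: mvar_geometric geom_mult)
  also have "\<dots> = (?x - ?y) * ?g * ?h" by (simp add: algebra_simps)
  finally show ?thesis by (simp add: kern_def)
qed

text \<open>The skew-orthogonality. In the surviving summand 1 + x_y turns the factor u_y into 1 +
  u_y, so the exponents m + 1 and m add up to the 2m + 1 of \<open>pade_sum\<close>.\<close>

lemma const_term_pade_factor_kern:
  assumes "y \<noteq> z" "i \<le> L"
  shows "const_term (pade_factor m L y * (kern y z * weight m z * minv z ^ i))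
    = (of_int (if i = L then (-1) ^ L * int (2 * m + 1 + L choose (m + 1)) else 0) :: 'a::comm_ring_1)"
proof -
  let ?Z = "(1 + minv z) ^ m * minv z ^ i :: 'a mlaurent"
  have "pade_factor m L y * (kern y z * weight m z * minv z ^ i)
      = pade_factor m L y * (1 + mvar y) * (?Z * geom y z)
        - pade_factor m L y * (?Z * inverse (1 - mvar z))"
  proof -
    have eq: "kern y z * weight m z * minv z ^ i = (kern y z * inverse (1 - mvar z)) * ?Z"
      by (simp add: weight_def mult_ac)
    show ?thesis
      unfolding eq kern_times_geometric left_diff_distrib right_diff_distrib by (simp only: mult_ac)
  qed
  moreover have "const_term (pade_factor m L y * (?Z * inverse (1 - mvar z))) = 0"
  proof -
    have "involves_only {z} (?Z * inverse (1 - mvar z))"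
      by (intro involves_only_mult involves_only_power involves_only_add) auto
    then have "const_term (pade_factor m L y * (?Z * inverse (1 - mvar z)))
        = const_term (pade_factor m L y) * const_term (?Z * inverse (1 - mvar z))"
      using assms(1) by (intro const_term_mult_disjoint[of "{y}" _ "{z}"]) auto
    then show ?thesis by (simp add: const_term_pade_factor)
  qed
  moreover have "pade_factor m L y * (1 + mvar y) * (?Z * geom y z)
      = (\<Sum>l\<le>L. of_int (pade_coeff m L l)
          * ((1 + minv y) ^ Suc m * minv y ^ l * (?Z * geom y z)))"
  proof -
    have eq: "minv y * (1 + mvar y) = (1 + minv y :: 'a mlaurent)"
      using mvar_inverse[of y, where ?'a = 'a] by (simp add: algebra_simps)
    have "minv y * (1 + minv y) ^ m * X * (1 + mvar y) = (1 + minv y) ^ Suc m * X"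
      for X :: "'a mlaurent"
    proof -
      have "minv y * (1 + minv y) ^ m * X * (1 + mvar y) = minv y * (1 + mvar y) * (1 + minv y) ^ m * X"
        by (simp only: mult_ac)
      then show ?thesis by (simp add: eq)
    qed
    then show ?thesis
      unfolding pade_factor_def by (simp only: sum_distrib_left sum_distrib_right) (simp only: mult_ac)
  qed
  moreover have "const_term (\<Sum>l\<le>L. of_int (pade_coeff m L l)
          * ((1 + minv y) ^ Suc m * minv y ^ l * (?Z * geom y z)))
      = of_int (\<Sum>l\<le>L. pade_coeff m L l * int (shifted_binomial (2 * m + 1) (i + m) l))"
    unfolding const_term_sum const_term_of_int_mult const_term_binomials_geom[OF assms(1)]
    by (simp add: mult_2)
  ultimately show ?thesis
    unfolding pade_sum[OF assms(2)]
    by (simp add: const_term_def mcoeff_minus)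
qed

text \<open>Used to separate u_k from the other variables. The vanishing of \<open>a i\<close> above
  the degree lets the shifted and unshifted sums in the induction share one bound.\<close>

lemma prod_diffs_expand:
  assumes "finite S"
  shows "\<exists>a :: nat \<Rightarrow> 'a::comm_ring_1 mlaurent. (\<forall>i. involves_only S (a i)) \<and> a (card S) = 1
    \<and> (\<forall>i>card S. a i = 0) \<and> (\<forall>t. (\<Prod>j\<in>S. t - minv j) = (\<Sum>i\<le>card S. t ^ i * a i))"
  using assms
proof (induction S)
  case empty
  show ?case by (rule exI[of _ "\<lambda>i. if i = 0 then 1 else 0"]) auto
next
  case (insert w S)
  then obtain a :: "nat \<Rightarrow> 'a mlaurent" where a: "\<And>i. involves_only S (a i)" "a (card S) = 1"
    "\<And>i. i > card S \<Longrightarrow> a i = 0" "\<And>t. (\<Prod>j\<in>S. t - minv j) = (\<Sum>i\<le>card S. t ^ i * a i)"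
    by blast
  define b where "b i = (if i = 0 then 0 else a (i - 1)) - minv w * a i" for i
  have "involves_only (insert w S) (b i)" for i
    unfolding b_def using involves_only_mono[OF a(1) subset_insertI]
    by (intro involves_only_diff involves_only_mult) auto
  moreover have "(\<Prod>j\<in>insert w S. t - minv j) = (\<Sum>i\<le>Suc (card S). t ^ i * b i)" for t
  proof -
    have "(\<Sum>i\<le>Suc (card S). t ^ i * b i)
        = (\<Sum>i\<le>Suc (card S). t ^ i * (if i = 0 then 0 else a (i - 1)))
          - minv w * (\<Sum>i\<le>Suc (card S). t ^ i * a i)"
      unfolding b_def by (simp add: right_diff_distrib sum_subtractf sum_distrib_left mult_ac del: sum.atMost_Suc)
    also have "(\<Sum>i\<le>Suc (card S). t ^ i * (if i = 0 then 0 else a (i - 1)))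
        = t * (\<Sum>i\<le>card S. t ^ i * a i)"
      by (subst sum.atMost_Suc_shift) (simp add: sum_distrib_left mult_ac)
    also have "(\<Sum>i\<le>Suc (card S). t ^ i * a i) = (\<Sum>i\<le>card S. t ^ i * a i)"
      by (simp add: a(3))
    finally show ?thesis
      using insert.hyps by (simp add: left_diff_distrib flip: a(4))
  qed
  ultimately show ?case
    using insert.hyps a(2,3) by (intro exI[of _ b]) (auto simp: b_def)
qed

text \<open>Indexed by a set, since the recursion removes an arbitrary pair of variables.\<close>

definition ct_integral :: "nat \<Rightarrow> nat set \<Rightarrow> 'a::comm_ring_1" where
  "ct_integral m K = const_term (pairprod K * (\<Prod>i\<in>K. weight m i))"

text \<open>
  The constant of the partial fraction expansion does not involve \<open>x\<^sub>z\<close>, hence is killed by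
  \<open>pade_factor\<close>.  In the \<open>k\<close>-th summand, orthogonality leaves only the leading power of \<open>1/x\<^sub>k\<close>.
\<close>

lemma const_term_pade_factor_pairprod:
  fixes m L :: nat
  assumes "finite K" "card K = Suc L" "z \<notin> K"
  defines "\<kappa> \<equiv> (-1) ^ L * int (2 * m + 1 + L choose (m + 1))"
  shows "const_term (pade_factor m L z
      * ((\<Prod>j\<in>K. kern z j) * pairprod K * (\<Prod>j\<in>K. weight m j)))
    = (\<Sum>k\<in>K. of_int \<kappa> * (ct_integral m (K - {k}) :: 'a::comm_ring_1))"
proof -
  let ?U = "pade_factor m L z :: 'a mlaurent"
  let ?W = "\<lambda>S. \<Prod>j\<in>S. weight m j :: 'a mlaurent"
  obtain C :: "'a mlaurent" where C: "involves_only K C"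
    and pf: "(\<Prod>j\<in>K. kern z j) * pairprod K
      = C + (\<Sum>k\<in>K. kern z k * inv_diffs K k * pairprod (K - {k}))"
    using kern_partial_fractions[OF assms(1), where ?'a = 'a] by blast
  have "const_term (?U * (C * ?W K)) = const_term ?U * const_term (C * ?W K)"
    using assms(3) C by (intro const_term_mult_disjoint[of "{z}" _ K]) auto
  then have zero: "const_term (?U * (C * ?W K)) = 0" by (simp add: const_term_pade_factor)
  have term_k: "const_term (?U * (kern z k * inv_diffs K k * pairprod (K - {k}) * ?W K))
      = of_int \<kappa> * ct_integral m (K - {k})" if k: "k \<in> K" for k
  proof -
    let ?R = "K - {k}"
    have R: "finite ?R" "card ?R = L" using assms(1,2) k by simp_all
    obtain a :: "nat \<Rightarrow> 'a mlaurent" where a: "\<And>i. involves_only ?R (a i)" "a L = 1"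
      "(\<Prod>j\<in>?R. minv k - minv j) = (\<Sum>i\<le>L. minv k ^ i * a i)"
      using prod_diffs_expand[OF R(1), where ?'a = 'a] unfolding R(2) by blast
    \<comment> \<open>Each summand is a series in x_z and x_k times one in the remaining variables,
      so its constant term factors.\<close>
    have expand: "?U * (kern z k * inv_diffs K k * pairprod ?R * ?W K)
        = (\<Sum>i\<le>L. ?U * (kern z k * weight m k * minv k ^ i) * (a i * (pairprod ?R * ?W ?R)))"
      unfolding inv_diffs_def a(3) prod.remove[OF assms(1) k, of "weight m"] sum_distrib_left sum_distrib_right
      by (rule sum.cong[OF refl]) (simp only: mult_ac)
    have "const_term (?U * (kern z k * inv_diffs K k * pairprod ?R * ?W K))
      = (\<Sum>i\<le>L. const_term (?U * (kern z k * weight m k * minv k ^ i))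
        * const_term (a i * (pairprod ?R * ?W ?R)))"
      unfolding expand const_term_sum
    proof (rule sum.cong[OF refl])
      fix i
      have "involves_only {z, k} (?U * (kern z k * weight m k * minv k ^ i))"
        by (intro involves_only_mult involves_only_power involves_only_pade_factor
            involves_only_kern involves_only_weight involves_only_inverse_mvar) simp_all
      moreover have "involves_only ?R (a i * (pairprod ?R * ?W ?R))"
        by (intro involves_only_mult involves_only_prod involves_only_pairprod involves_only_weight a(1))
      moreover have "{z, k} \<inter> ?R = {}" using assms(3) by auto
      ultimately show "const_term (?U * (kern z k * weight m k * minv k ^ i) * (a i * (pairprod ?R * ?W ?R)))
          = const_term (?U * (kern z k * weight m k * minv k ^ i))
            * const_term (a i * (pairprod ?R * ?W ?R))"
        by (rule const_term_mult_disjoint)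
    qed
    also have "\<dots> = (\<Sum>i\<le>L. if i = L then of_int \<kappa> * const_term (a i * (pairprod ?R * ?W ?R)) else 0)"
    proof (rule sum.cong[OF refl])
      fix i assume "i \<in> {..L}"
      then have "i \<le> L" "z \<noteq> k" using assms(3) k by auto
      then have "const_term (?U * (kern z k * weight m k * minv k ^ i))
          = of_int (if i = L then \<kappa> else 0)"
        unfolding \<kappa>_def by (intro const_term_pade_factor_kern)
      then show "const_term (?U * (kern z k * weight m k * minv k ^ i))
            * const_term (a i * (pairprod ?R * ?W ?R))
          = (if i = L then of_int \<kappa> * const_term (a i * (pairprod ?R * ?W ?R)) else 0)"
        by (cases "i = L") simp_all
    qed
    also have "\<dots> = of_int \<kappa> * const_term (a L * (pairprod ?R * ?W ?R))" by simp
    finally show ?thesis by (simp add: a(2) ct_integral_def)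
  qed
  have "?U * ((\<Prod>j\<in>K. kern z j) * pairprod K * ?W K)
      = ?U * (C * ?W K)
        + (\<Sum>k\<in>K. ?U * (kern z k * inv_diffs K k * pairprod (K - {k}) * ?W K))"
    unfolding pf by (simp only: distrib_left distrib_right sum_distrib_left sum_distrib_right)
  then show ?thesis by (simp add: const_term_add const_term_sum zero term_k)
qed

text \<open>
  Lagrange interpolation applied to \<open>(1 - u) * (\<Sum>l\<le>L. pade_coeff m L l * u\<^sup>l)\<close>, a polynomial of
  degree \<open>card K - 1\<close>.
\<close>

lemma ct_integral_recursion:
  fixes m L :: nat
  assumes "finite K" "card K = L + 2"
  defines "\<kappa> \<equiv> (-1) ^ L * int (2 * m + 1 + L choose (m + 1))"
  shows "of_int (pade_coeff m L L) * ct_integral m K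
    = (\<Sum>z\<in>K. \<Sum>k\<in>K - {z}. of_int \<kappa> * (ct_integral m (K - {z} - {k}) :: 'a::comm_ring_1))"
proof -
  let ?g = "\<lambda>l. of_int (pade_coeff m L l) :: 'a mlaurent"
  let ?T = "\<lambda>z. (\<Prod>l\<in>K - {z}. kern z l) * pairprod (K - {z}) :: 'a mlaurent"
  let ?W = "\<lambda>S. \<Prod>j\<in>S. weight m j :: 'a mlaurent"
  have "(\<Sum>z\<in>K. (1 - minv z) * (\<Sum>l\<le>L. ?g l * minv z ^ l) * ?T z)
      = (\<Sum>z\<in>K. \<Sum>l\<le>L. ?g l * (minv z ^ l * ?T z - minv z ^ Suc l * ?T z))"
    unfolding sum_distrib_left sum_distrib_right
    by (intro sum.cong refl) (simp add: algebra_simps)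
  also have "\<dots> = (\<Sum>l\<le>L. ?g l * (lagrange_sum l K - lagrange_sum (Suc l) K))"
    unfolding lagrange_sum_def
    by (subst sum.swap) (simp only: sum_subtractf[symmetric] sum_distrib_left mult.assoc)
  \<comment> \<open>Since \<open>card K = L + 2\<close>, only \<open>lagrange_sum (Suc L) K\<close>
    survives. Its minus sign stems from 1 - u and cancels against that of
    \<open>weight_factor\<close>.\<close>
  also have "\<dots> = (\<Sum>l\<in>{L}. - ?g l * pairprod K)"
    by (rule sum.mono_neutral_cong_right) (use assms in \<open>auto simp: lagrange_sum_eq\<close>)
  finally have "?g L * (pairprod K * ?W K)
      = - (\<Sum>z\<in>K. (1 - minv z) * (\<Sum>l\<le>L. ?g l * minv z ^ l) * ?T z) * ?W K"
    by (simp add: mult.assoc)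
  also have "\<dots> = (\<Sum>z\<in>K. pade_factor m L z * (?T z * ?W (K - {z})))"
    unfolding sum_distrib_right sum_negf[symmetric]
  proof (rule sum.cong[OF refl])
    fix z assume z: "z \<in> K"
    have "- ((1 - minv z) * (\<Sum>l\<le>L. ?g l * minv z ^ l) * ?T z) * ?W K
        = - ((1 - minv z) * weight m z) * (\<Sum>l\<le>L. ?g l * minv z ^ l) * (?T z * ?W (K - {z}))"
      unfolding prod.remove[OF assms(1) z, of "weight m"] by (simp add: mult_ac)
    then show "- ((1 - minv z) * (\<Sum>l\<le>L. ?g l * minv z ^ l) * ?T z) * ?W K
        = pade_factor m L z * (?T z * ?W (K - {z}))"
      unfolding weight_factor pade_factor_def by simp
  qed
  finally have "const_term (?g L * (pairprod K * ?W K))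
      = (\<Sum>z\<in>K. const_term (pade_factor m L z * (?T z * ?W (K - {z}))))"
    by (simp only: const_term_sum)
  also have "\<dots> = (\<Sum>z\<in>K. \<Sum>k\<in>K - {z}. of_int \<kappa> * ct_integral m (K - {z} - {k}))"
    unfolding \<kappa>_def
    by (intro sum.cong refl const_term_pade_factor_pairprod) (use assms in auto)
  finally show ?thesis by (simp only: const_term_of_int_mult ct_integral_def)
qed

section \<open>Evaluation of the constant terms\<close>

lemma const_term_weight: "const_term (weight m i) = (2 :: 'a::comm_ring_1) ^ m"
proof -
  \<comment> \<open>Every coefficient of the geometric series is 1, so the binomial coefficients of
    (1 + u)^m simply add up.\<close>
  have one: "const_term (minv i ^ a * inverse (1 - mvar i)) = (1 :: 'a)" for a
  proof -
    let ?d = "Poly_Mapping.single i (1::int)"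
    have "((+) ?d ^^ a) 0 = Poly_Mapping.single i (int a)"
      by (induction a) (simp_all add: single_add[symmetric])
    then have "\<exists>k. Poly_Mapping.single i (int a) = ((+) ?d ^^ k) 0" by metis
    then have "(if \<exists>k. Poly_Mapping.single i (int a) = ((+) ?d ^^ k) 0 then 1 else 0) = (1 :: 'a)"
      by (rule if_P)
    moreover have "?d \<noteq> 0" "Poly_Mapping.lookup ?d j \<ge> 0" for j
      by (auto simp: lookup_single when_def)
    ultimately have "mcoeff (inverse (1 - mmonom ?d)) (Poly_Mapping.single i (int a)) = (1 :: 'a)"
      by (subst mcoeff_inverse_one_minus_mmonom)
    then show ?thesis
      unfolding inverse_mvar_power const_term_mmonom_mult
      unfolding mvar_def by (simp add: single_uminus)
  qed
  have "const_term (weight m i) = (\<Sum>a\<le>m. of_nat (m choose a) :: 'a)"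
    unfolding weight_def one_plus_minv_power sum_distrib_right const_term_sum mult.assoc
      const_term_of_int_mult one by simp
  also have "\<dots> = of_nat (2 ^ m)" by (simp only: choose_row_sum flip: of_nat_sum)
  finally show ?thesis by simp
qed

text \<open>Induction in steps of two, hence two base cases. The recursion yields the value times a
  binomial coefficient, which is cancelled over \<open>rat\<close>.\<close>

lemma ct_integral_eq:
  assumes "finite K"
  shows "ct_integral m K = (fact (card K)
    * (\<Prod>j<card K. \<Prod>i = 1..m. of_nat (2 * i + j) / of_nat (i + j)) :: rat)"
  using assms
proof (induction "card K" arbitrary: K rule: less_induct)
  case less
  let ?R = "\<lambda>n. \<Prod>j<n. \<Prod>i = 1..m. of_nat (2 * i + j) / of_nat (i + j) :: rat"
  consider "card K = 0" | "card K = 1" | L where "card K = L + 2"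
    by (metis One_nat_def add_2_eq_Suc' not0_implies_Suc)
  then show ?case
  proof cases
    case 1
    then show ?thesis using less.prems by (simp add: ct_integral_def)
  next
    case 2
    then obtain i where "K = {i}" by (auto simp: card_1_singleton_iff)
    then show ?thesis by (simp add: ct_integral_def const_term_weight)
  next
    case (3 L)
    let ?b = "of_nat (m + 1 + L choose L) :: rat" and ?c = "of_nat (2 * m + 1 + L choose (m + 1)) :: rat"
    have "ct_integral m (K - {z} - {k}) = fact L * ?R L" if "z \<in> K" "k \<in> K - {z}" for z k
    proof -
      have "card (K - {z} - {k}) = L" using that 3 less.prems by simp
      then show ?thesis using less.hyps[of "K - {z} - {k}"] less.prems 3 by simp
    qed
    then have "(-1) ^ L * (?b * ct_integral m K)
        = (\<Sum>z\<in>K. \<Sum>k\<in>K - {z}. (-1) ^ L * ?c * (fact L * ?R L))"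
      using ct_integral_recursion[OF less.prems 3, of m, where ?'a = rat]
      by (simp add: pade_coeff_last mult_ac)
    \<comment> \<open>There are (L + 2)(L + 1) ordered pairs, all with equal terms; this count turns
      L! into (L + 2)!.\<close>
    also have "\<dots> = (-1) ^ L * (of_nat ((L + 2) * (L + 1)) * (?c * (fact L * ?R L)))"
      using less.prems 3 by (simp add: algebra_simps)
    finally have "?b * ct_integral m K = of_nat ((L + 2) * (L + 1)) * fact L * (?c * ?R L)"
      by (simp add: mult_ac)
    also have "of_nat ((L + 2) * (L + 1)) * fact L = (fact (L + 2) :: rat)"
      by (simp add: algebra_simps)
    also have "?c * ?R L = ?R (L + 2) * ?b"
      by (rule product_ratio[symmetric])
    finally have "?b * ct_integral m K = ?b * (fact (L + 2) * ?R (L + 2))"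
      by (simp only: mult_ac)
    moreover have "?b \<noteq> 0" by simp
    ultimately have "ct_integral m K = fact (L + 2) * ?R (L + 2)"
      by (simp only: mult_cancel_left simp_thms)
    then show ?thesis by (simp only: 3)
  qed
qed

section \<open>Translation to the product over ordered pairs\<close>

lemma pairprod_eq:
  "pairprod {1..n} = (\<Prod>(i, j) \<in> {(i, j). i \<in> {1..n} \<and> j \<in> {1..n} \<and> i \<noteq> j}. 1 - mvar i / mvar j)
    * (\<Prod>(i, j) \<in> {(i, j). 1 \<le> i \<and> i < j \<and> j \<le> n}. geom i j :: 'a::comm_ring_1 mlaurent)"
proof -
  let ?P = "{(i, j). 1 \<le> i \<and> i < j \<and> j \<le> n}"
  let ?f = "\<lambda>(i, j). 1 - mvar i / mvar j :: 'a mlaurent"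
  have fin: "finite ?P" by (rule finite_subset[of _ "{1..n} \<times> {1..n}"]) auto
  have "{(i, j). i \<in> {1..n} \<and> j \<in> {1..n} \<and> i \<noteq> j} = ?P \<union> prod.swap ` ?P"
    by (auto simp: linorder_neq_iff image_iff)
  then have "prod ?f {(i, j). i \<in> {1..n} \<and> j \<in> {1..n} \<and> i \<noteq> j} = prod ?f ?P * prod ?f (prod.swap ` ?P)"
    by (simp only:) (rule prod.union_disjoint, use fin in auto)
  also have "prod ?f (prod.swap ` ?P) = (\<Prod>(i, j)\<in>?P. 1 - mvar j / mvar i)"
    by (subst prod.reindex) (auto simp: o_def intro!: prod.cong)
  finally have "prod ?f {(i, j). i \<in> {1..n} \<and> j \<in> {1..n} \<and> i \<noteq> j}
      = (\<Prod>(i, j)\<in>?P. (1 - mvar i / mvar j) * (1 - mvar j / mvar i))"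
    by (simp add: case_prod_unfold prod.distrib)
  moreover have "pairprod {1..n} = (\<Prod>(i, j)\<in>?P. pairk i j :: 'a mlaurent)"
    unfolding pairprod_def by (rule prod.cong) auto
  moreover have "pairk i j = (1 - mvar i / mvar j) * (1 - mvar j / mvar i) * (geom i j :: 'a mlaurent)" for i j
  proof -
    \<comment> \<open>The correction is p + q - 1 - p q with p = x_i u_i and q = x_j u_j; it
      vanishes because p = q = 1.\<close>
    have "(minv i - minv j) * (mvar i - mvar j)
        = (1 - mvar i * minv j) * (1 - mvar j * minv i) + (mvar i * minv i + mvar j * minv j - 1
          - mvar i * minv i * (mvar j * minv j) :: 'a mlaurent)"
      by (simp add: algebra_simps)
    then have "(minv i - minv j) * (mvar i - mvar j)
        = (1 - mvar i * minv j) * (1 - mvar j * minv i :: 'a mlaurent)"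
      by (simp add: mvar_inverse)
    then show ?thesis by (simp add: pairk_def kern_def divide_mlaurent_def mult.assoc[symmetric])
  qed
  ultimately show ?thesis by (simp add: case_prod_unfold prod.distrib)
qed

theorem mainTheorem2:
  fixes n m :: nat
  assumes "n \<ge> 1"
  shows "1 / fact n * const_term
      (((\<Prod>(i, j) \<in> {(i, j). i \<in> {1..n} \<and> j \<in> {1..n} \<and> i \<noteq> j}. 1 - mvar i / mvar j)
          * (\<Prod>i = 1..n. (1 + inverse (mvar i)) ^ m))
        / ((\<Prod>i = 1..n. 1 - mvar i)
          * (\<Prod>(i, j) \<in> {(i, j). 1 \<le> i \<and> i < j \<and> j \<le> n}. 1 - mvar i * mvar j)))
    = ((\<Prod>j = 0..n - 1. \<Prod>i = 1..m. of_nat (2 * i + j) / of_nat (i + j)) :: rat)"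
proof -
  let ?P = "{(i, j). 1 \<le> i \<and> i < j \<and> j \<le> n}"
  let ?N = "(\<Prod>(i, j) \<in> {(i, j). i \<in> {1..n} \<and> j \<in> {1..n} \<and> i \<noteq> j}. 1 - mvar i / mvar j) :: rat mlaurent"
  let ?M = "(\<Prod>i = 1..n. (1 + inverse (mvar i)) ^ m) :: rat mlaurent"
  let ?D = "(\<Prod>i = 1..n. 1 - mvar i) * (\<Prod>(i, j)\<in>?P. 1 - mvar i * mvar j) :: rat mlaurent"
  let ?E = "(\<Prod>i = 1..n. inverse (1 - mvar i)) * (\<Prod>(i, j)\<in>?P. geom i j) :: rat mlaurent"
  \<comment> \<open>Division is by the denominator as a whole, so an explicit inverse of the full
    product is exhibited.\<close>
  have "?D * ?E = (\<Prod>i = 1..n. (1 - mvar i) * inverse (1 - mvar i))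
      * (\<Prod>(i, j)\<in>?P. (1 - mvar i * mvar j) * geom i j)"
    by (simp add: case_prod_unfold prod.distrib mult_ac)
  then have "?D * ?E = 1" by (simp add: mvar_geometric geom_mult case_prod_unfold)
  then have "inverse ?D = ?E" by (rule mlaurent_inverse_unique)
  then have "?N * ?M / ?D = pairprod {1..n} * (\<Prod>i = 1..n. weight m i)"
    unfolding divide_mlaurent_def[of "?N * ?M"] pairprod_eq
    by (simp add: weight_def prod.distrib mult_ac)
  then have "const_term (?N * ?M / ?D) = ct_integral m {1..n}" by (simp only: ct_integral_def)
  \<comment> \<open>For n = 0 the right-hand interval would be {0}.\<close>
  moreover have "{..<n} = {0..n - 1}" using assms by auto
  ultimately show ?thesis by (simp add: ct_integral_eq)
qed

end
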